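(* Let $0<M_1<M_2$ and $R_2>R_1>2M_2$, and let $\delta[u]:=\mathcal J[u]-\lambda_*$ for $u\in\mathcal A_{BV}$. Consider the two stability estimates, with constants $C$ depending only on $M_1,M_2,R_1,R_2$, valid for all $u\in\mathcal A_{BV}$ with $\delta[u]\le1$: (profile) $\|u-u_*\|_{L^1}\le C\,\delta[u]^{\gamma_0}$, (metric) $\|P_u-P_*\|_{L^\infty}+\|m_u-m_*\|_{L^\infty}+\|F_u-F_*\|_{L^\infty}+\|F_u^{-1}-F_*^{-1}\|_{L^\infty}\le C\,\delta[u]^{\gamma_0}$, where $\gamma_0=\tfrac12$ in the critical regime $a=x_0$, and $\gamma_0=1$ in the strict boundary regime $a=R_1>x_0$. The square-root exponent in the critical regime and the linear exponent in the strict boundary regime are optimal: they cannot be replaced by larger powers of the deficit, either in the $BV$ class or uniformly in the smooth class. That is, in each regime, for every $\gamma>\gamma_0$ and for each of the two estimates, there is no constant $C$ for which the estimate with $\delta[u]^{\gamma}$ in place of $\delta[u]^{\gamma_0}$ holds for all $u\in\mathcal A_{BV}$ with $\delta[u]\le1$, and there is no constant $C$ for which it holds for all $u\in\mathcal A_\infty$ with $\delta[u]\le1$.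
   Context: $\Delta M:=M_2-M_1$. $\mathcal A_\infty$: functions $u\in C^\infty(\mathbb R)$ with $u\ge0$, $\operatorname{supp}u\subset(R_1,R_2)$, $\int_{R_1}^{R_2}r^2u\,dr=1$. $\mathcal A_{BV}$ (which contains $\mathcal A_\infty$): functions $u\in BV(\mathbb R)$ with $u\ge0$ a.e., $u=0$ a.e. on $\mathbb R\setminus[R_1,R_2]$, $\int_{R_1}^{R_2}r^2u\,dr=1$. $Du=(Du)^+-(Du)^-$ is the Jordan decomposition of the distributional derivative. For $u\in\mathcal A_{BV}$ and $r\in[R_1,R_2]$: $P_u(r)=\int_{R_1}^r s^2u(s)\,ds$, $m_u(r)=M_1+\Delta M\,P_u(r)$, $F_u(r)=1-\frac{2m_u(r)}{r}$ (which is bounded below by $1-2M_2/R_1>0$), and $\mathcal J[u]=\int_{[R_1,R_2]}\frac{r^3}{\sqrt{F_u(r)}}\,d(Du)^+(r)$. The $L^\infty$ norms are over $[R_1,R_2]$. $A(r)=\frac{R_2^3-r^3}{3}$, $q(r)=\frac{r^{7/2}}{\sqrt{r-2M_1}}$, $\Psi=q/A$. $x_0$ is the unique real solution of $M_1x_0^3+3R_2^3x_0-7M_1R_2^3=0$ (it satisfies $2M_1<x_0<7M_1/3$). $a=\max\{R_1,x_0\}$, $\lambda_*=\Psi(a)$ (the minimum of $\mathcal J$ over $\mathcal A_{BV}$), $H_*=1/A(a)$, $u_*=H_*\mathbf 1_{(a,R_2)}$ (the unique minimizer), and $P_*=P_{u_*}$, $m_*=m_{u_*}$, $F_*=F_{u_*}$.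 *)

theory Defs
  imports "HOL-Probability.Essential_Supremum"
begin

definition smooth :: "(real \<Rightarrow> real) \<Rightarrow> bool" where
  "smooth f \<longleftrightarrow> (\<forall>n x. (deriv ^^ n) f differentiable at x)"

definition supp :: "(real \<Rightarrow> real) \<Rightarrow> real set" where
  "supp f = closure {x. f x \<noteq> 0}"

definition test_function :: "(real \<Rightarrow> real) \<Rightarrow> bool" where
  "test_function \<phi> \<longleftrightarrow> smooth \<phi> \<and> compact (supp \<phi>)"

definition finite_borel_measure :: "real measure \<Rightarrow> bool" where
  "finite_borel_measure \<mu> \<longleftrightarrow> sets \<mu> = sets borel \<and> finite_measure \<mu>"

text \<open>A finite signed measure is represented by a pair of finite Borel measures
  \<open>\<mu>\<close>, \<open>\<nu>\<close>, standing for \<open>\<mu> - \<nu>\<close>. The next predicate says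
  \<open>Du = \<mu> - \<nu>\<close> in the sense of distributions.\<close>

definition has_derivative_measure ::
    "(real \<Rightarrow> real) \<Rightarrow> real measure \<Rightarrow> real measure \<Rightarrow> bool" where
  "has_derivative_measure u \<mu> \<nu> \<longleftrightarrow>
     finite_borel_measure \<mu> \<and> finite_borel_measure \<nu> \<and>
     (\<forall>\<phi>. test_function \<phi> \<longrightarrow>
        (LINT x|lborel. u x * deriv \<phi> x) = - ((LINT x|\<mu>. \<phi> x) - (LINT x|\<nu>. \<phi> x)))"

text \<open>Elements are Borel representatives; every class in \<open>L\<^sup>1\<close> has one.\<close>

definition BV :: "(real \<Rightarrow> real) set" where
  "BV = {u. integrable lborel u \<and> (\<exists>\<mu> \<nu>. has_derivative_measure u \<mu> \<nu>)}"

definition mutually_singular :: "real measure \<Rightarrow> real measure \<Rightarrow> bool" where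
  "mutually_singular \<mu> \<nu> \<longleftrightarrow>
     (\<exists>S\<in>sets borel. emeasure \<mu> S = 0 \<and> emeasure \<nu> (- S) = 0)"

text \<open>\<open>(Du)\<^sup>+\<close>: the first component of the Jordan decomposition of \<open>Du\<close>, that is, of
  the unique mutually singular pair representing \<open>Du\<close>.\<close>

definition Du_pos :: "(real \<Rightarrow> real) \<Rightarrow> real measure" where
  "Du_pos u = (THE \<mu>. \<exists>\<nu>. has_derivative_measure u \<mu> \<nu> \<and> mutually_singular \<mu> \<nu>)"

definition A_smooth :: "real \<Rightarrow> real \<Rightarrow> (real \<Rightarrow> real) set" where
  "A_smooth R1 R2 = {u. smooth u \<and> (\<forall>x. 0 \<le> u x) \<and> supp u \<subseteq> {R1<..<R2} \<and>
     (LINT r:{R1..R2}|lborel. r\<^sup>2 * u r) = 1}"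

definition A_BV :: "real \<Rightarrow> real \<Rightarrow> (real \<Rightarrow> real) set" where
  "A_BV R1 R2 = {u \<in> BV. (AE x in lborel. 0 \<le> u x) \<and>
     (AE x in lborel. x \<notin> {R1..R2} \<longrightarrow> u x = 0) \<and>
     (LINT r:{R1..R2}|lborel. r\<^sup>2 * u r) = 1}"

definition P_fn :: "real \<Rightarrow> (real \<Rightarrow> real) \<Rightarrow> real \<Rightarrow> real" where
  "P_fn R1 u r = (LINT s:{R1..r}|lborel. s\<^sup>2 * u s)"

definition m_fn :: "real \<Rightarrow> real \<Rightarrow> real \<Rightarrow> (real \<Rightarrow> real) \<Rightarrow> real \<Rightarrow> real" where
  "m_fn M1 M2 R1 u r = M1 + (M2 - M1) * P_fn R1 u r"

definition F_fn :: "real \<Rightarrow> real \<Rightarrow> real \<Rightarrow> (real \<Rightarrow> real) \<Rightarrow> real \<Rightarrow> real" where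
  "F_fn M1 M2 R1 u r = 1 - 2 * m_fn M1 M2 R1 u r / r"

definition J :: "real \<Rightarrow> real \<Rightarrow> real \<Rightarrow> real \<Rightarrow> (real \<Rightarrow> real) \<Rightarrow> real" where
  "J M1 M2 R1 R2 u =
     (LINT r:{R1..R2}|Du_pos u. r ^ 3 / sqrt (F_fn M1 M2 R1 u r))"

definition A_fn :: "real \<Rightarrow> real \<Rightarrow> real" where
  "A_fn R2 r = (R2 ^ 3 - r ^ 3) / 3"

definition q_fn :: "real \<Rightarrow> real \<Rightarrow> real" where
  "q_fn M1 r = r powr (7/2) / sqrt (r - 2 * M1)"

definition Psi :: "real \<Rightarrow> real \<Rightarrow> real \<Rightarrow> real" where
  "Psi M1 R2 r = q_fn M1 r / A_fn R2 r"

definition x0 :: "real \<Rightarrow> real \<Rightarrow> real" where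
  "x0 M1 R2 = (THE x. M1 * x ^ 3 + 3 * R2 ^ 3 * x - 7 * M1 * R2 ^ 3 = 0)"

definition a_opt :: "real \<Rightarrow> real \<Rightarrow> real \<Rightarrow> real" where
  "a_opt M1 R1 R2 = max R1 (x0 M1 R2)"

definition lambda_opt :: "real \<Rightarrow> real \<Rightarrow> real \<Rightarrow> real" where
  "lambda_opt M1 R1 R2 = Psi M1 R2 (a_opt M1 R1 R2)"

definition H_opt :: "real \<Rightarrow> real \<Rightarrow> real \<Rightarrow> real" where
  "H_opt M1 R1 R2 = 1 / A_fn R2 (a_opt M1 R1 R2)"

definition u_opt :: "real \<Rightarrow> real \<Rightarrow> real \<Rightarrow> real \<Rightarrow> real" where
  "u_opt M1 R1 R2 r = H_opt M1 R1 R2 * indicator {a_opt M1 R1 R2<..<R2} r"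

definition deficit :: "real \<Rightarrow> real \<Rightarrow> real \<Rightarrow> real \<Rightarrow> (real \<Rightarrow> real) \<Rightarrow> real" where
  "deficit M1 M2 R1 R2 u = J M1 M2 R1 R2 u - lambda_opt M1 R1 R2"

definition Linf_norm :: "real \<Rightarrow> real \<Rightarrow> (real \<Rightarrow> real) \<Rightarrow> ereal" where
  "Linf_norm R1 R2 f = esssup (restrict_space lborel {R1..R2}) (\<lambda>r. ereal \<bar>f r\<bar>)"

definition profile_error :: "real \<Rightarrow> real \<Rightarrow> real \<Rightarrow> (real \<Rightarrow> real) \<Rightarrow> real" where
  "profile_error M1 R1 R2 u = (LINT r|lborel. \<bar>u r - u_opt M1 R1 R2 r\<bar>)"

definition metric_error :: "real \<Rightarrow> real \<Rightarrow> real \<Rightarrow> real \<Rightarrow> (real \<Rightarrow> real) \<Rightarrow> ereal" where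
  "metric_error M1 M2 R1 R2 u =
    (let u' = u_opt M1 R1 R2 in
       Linf_norm R1 R2 (\<lambda>r. P_fn R1 u r - P_fn R1 u' r)
     + Linf_norm R1 R2 (\<lambda>r. m_fn M1 M2 R1 u r - m_fn M1 M2 R1 u' r)
     + Linf_norm R1 R2 (\<lambda>r. F_fn M1 M2 R1 u r - F_fn M1 M2 R1 u' r)
     + Linf_norm R1 R2 (\<lambda>r. inverse (F_fn M1 M2 R1 u r) - inverse (F_fn M1 M2 R1 u' r)))"

text \<open>Since \<open>lambda_opt\<close> is the minimum of \<open>J\<close> over \<open>A_BV\<close>, which contains
  \<open>A_smooth\<close>, the base of \<open>powr\<close> below is never negative.\<close>

definition profile_estimate ::
    "real \<Rightarrow> real \<Rightarrow> real \<Rightarrow> real \<Rightarrow> (real \<Rightarrow> real) set \<Rightarrow> real \<Rightarrow> bool" where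
  "profile_estimate M1 M2 R1 R2 \<A> \<gamma> \<longleftrightarrow>
     (\<exists>C::real. \<forall>u\<in>\<A>. deficit M1 M2 R1 R2 u \<le> 1 \<longrightarrow>
        profile_error M1 R1 R2 u \<le> C * deficit M1 M2 R1 R2 u powr \<gamma>)"

definition metric_estimate ::
    "real \<Rightarrow> real \<Rightarrow> real \<Rightarrow> real \<Rightarrow> (real \<Rightarrow> real) set \<Rightarrow> real \<Rightarrow> bool" where
  "metric_estimate M1 M2 R1 R2 \<A> \<gamma> \<longleftrightarrow>
     (\<exists>C::real. \<forall>u\<in>\<A>. deficit M1 M2 R1 R2 u \<le> 1 \<longrightarrow>
        metric_error M1 M2 R1 R2 u \<le> ereal (C * deficit M1 M2 R1 R2 u powr \<gamma>))"

end

theory Submission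
  imports Defs
begin

text \<open>A competitor that vanishes up to \<open>a + \<epsilon>\<close> differs from the minimizer
  \<open>H\<^sub>* 1\<^bsub>(a, R\<^sub>2)\<^esub>\<close> by an amount of order \<open>\<epsilon>\<close>, both in \<open>L\<^sup>1\<close> and in the
  enclosed mass. Smoothing the multiple of the indicator of \<open>(a + \<epsilon>, R\<^sub>2)\<close> with unit mass at a
  scale \<open>h\<close> yields an element of \<open>A_smooth\<close> whose energy tends to \<open>\<Psi>(a + \<epsilon>)\<close> as
  \<open>h \<rightarrow> 0\<close>, since all the increase of the profile takes place where the mass function is still
  \<open>M\<^sub>1 + O(h)\<close>. The derivative of \<open>\<Psi>\<close> is a positive multiple of the cubic defining
  \<open>x\<^sub>0\<close>, so \<open>\<Psi>\<close> is strictly increasing to the right of \<open>a\<close>, and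
  \<open>\<Psi>(a + \<epsilon>) - \<Psi>(a)\<close> is \<open>O(\<epsilon>)\<close> in general and \<open>O(\<epsilon>\<^sup>2)\<close> when
  \<open>a = x\<^sub>0\<close>. Strictness lets \<open>h\<close> be chosen so that the deficit lies between \<open>0\<close> and twice
  this increment, which avoids proving that \<open>\<Psi>(a)\<close> is the minimum of the energy.\<close>

section \<open>Closure properties of smooth functions\<close>

fun times_differentiable :: "nat \<Rightarrow> (real \<Rightarrow> real) \<Rightarrow> bool" where
  "times_differentiable 0 f \<longleftrightarrow> True"
| "times_differentiable (Suc n) f \<longleftrightarrow>
     (\<forall>x. f differentiable at x) \<and> times_differentiable n (deriv f)"

text \<open>The recursion takes the derivative innermost in the iterate, so closure properties
  follow by induction on the order with the function generalised. This characterisation is the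
  bridge back to \<open>smooth\<close>.\<close>

lemma times_differentiable_iff:
  "times_differentiable n f \<longleftrightarrow> (\<forall>k<n. \<forall>x. (deriv ^^ k) f differentiable at x)"
proof (induction n arbitrary: f)
  case (Suc n)
  show ?case
    unfolding times_differentiable.simps Suc
    by (subst All_less_Suc2) (simp add: funpow_swap1)
qed simp

lemma smooth_iff_times_differentiable: "smooth f \<longleftrightarrow> (\<forall>n. times_differentiable n f)"
  unfolding smooth_def times_differentiable_iff by auto

lemma times_differentiable_mono: "times_differentiable (Suc n) f \<Longrightarrow> times_differentiable n f"
  unfolding times_differentiable_iff by auto

lemma times_differentiable_SucI:
  assumes "\<And>x. (f has_real_derivative f' x) (at x)" "times_differentiable n f'"
  shows "times_differentiable (Suc n) f"
proof -
  have "deriv f = f'"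
    using assms(1) by (auto intro: DERIV_imp_deriv)
  then show ?thesis
    using assms by (auto simp: real_differentiable_def)
qed

lemma times_differentiable_SucD:
  assumes "times_differentiable (Suc n) f"
  shows "(f has_real_derivative deriv f x) (at x)" "times_differentiable n (deriv f)"
  using assms by (auto simp: DERIV_deriv_iff_real_differentiable)

lemma times_differentiable_const: "times_differentiable n (\<lambda>x. c)"
  by (induction n arbitrary: c) (auto intro!: times_differentiable_SucI derivative_eq_intros)

lemma times_differentiable_add:
  "times_differentiable n f \<Longrightarrow> times_differentiable n g \<Longrightarrow> times_differentiable n (\<lambda>x. f x + g x)"
proof (induction n arbitrary: f g)
  case (Suc n)
  note f = times_differentiable_SucD[OF Suc.prems(1)] and g = times_differentiable_SucD[OF Suc.prems(2)]
  show ?case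
    by (rule times_differentiable_SucI[OF DERIV_add[OF f(1) g(1)]]) (rule Suc.IH[OF f(2) g(2)])
qed simp

lemma times_differentiable_mult:
  "times_differentiable n f \<Longrightarrow> times_differentiable n g \<Longrightarrow> times_differentiable n (\<lambda>x. f x * g x)"
proof (induction n arbitrary: f g)
  case (Suc n)
  note f = times_differentiable_SucD[OF Suc.prems(1)] and g = times_differentiable_SucD[OF Suc.prems(2)]
  note m = Suc.prems[THEN times_differentiable_mono]
  show ?case
    by (rule times_differentiable_SucI[OF DERIV_mult[OF f(1) g(1)]])
      (intro times_differentiable_add Suc.IH f(2) g(2) m)
qed simp

lemma times_differentiable_cmult:
  "times_differentiable n f \<Longrightarrow> times_differentiable n (\<lambda>x. c * f x)"
  by (intro times_differentiable_mult times_differentiable_const)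

lemma times_differentiable_diff:
  "times_differentiable n f \<Longrightarrow> times_differentiable n g \<Longrightarrow> times_differentiable n (\<lambda>x. f x - g x)"
  using times_differentiable_add[of n f "\<lambda>x. -1 * g x"] times_differentiable_cmult[of n g "-1"]
  by simp

text \<open>The derivative of 1/f is -f' (1/f)^2, a product of f' and 1/f itself. The induction
  hypothesis for 1/f at the lower order therefore suffices.\<close>

lemma times_differentiable_inverse:
  assumes "\<And>x. f x \<noteq> 0"
  shows "times_differentiable n f \<Longrightarrow> times_differentiable n (\<lambda>x. inverse (f x))"
proof (induction n)
  case (Suc n)
  note f = times_differentiable_SucD[OF Suc.prems]
  have i: "times_differentiable n (\<lambda>x. inverse (f x))"
    by (rule Suc.IH[OF times_differentiable_mono[OF Suc.prems]])
  have "((\<lambda>x. inverse (f x)) has_real_derivative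
      -1 * (deriv f x * (inverse (f x) * inverse (f x)))) (at x)" for x
    using DERIV_inverse_fun[OF f(1)[of x] assms] by (simp add: power2_eq_square mult_ac)
  then show ?case
    by (rule times_differentiable_SucI)
      (intro times_differentiable_cmult times_differentiable_mult f i)
qed simp

lemma times_differentiable_affine:
  "times_differentiable n f \<Longrightarrow> times_differentiable n (\<lambda>x. f (c * x + d))"
proof (induction n arbitrary: f)
  case (Suc n)
  note f = times_differentiable_SucD[OF Suc.prems]
  have "((\<lambda>x. f (c * x + d)) has_real_derivative c * deriv f (c * x + d)) (at x)" for x
    by (rule DERIV_cong[OF DERIV_chain2[where g="\<lambda>x. c * x + d", OF f(1)]])
      (auto intro!: derivative_eq_intros)
  then show ?case
    by (rule times_differentiable_SucI) (intro times_differentiable_cmult Suc.IH f)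
qed simp

lemma smooth_diff: "smooth f \<Longrightarrow> smooth g \<Longrightarrow> smooth (\<lambda>x. f x - g x)"
  by (simp add: smooth_iff_times_differentiable times_differentiable_diff)

lemma smooth_cmult: "smooth f \<Longrightarrow> smooth (\<lambda>x. c * f x)"
  by (simp add: smooth_iff_times_differentiable times_differentiable_cmult)

lemma smooth_affine: "smooth f \<Longrightarrow> smooth (\<lambda>x. f (c * x + d))"
  by (simp add: smooth_iff_times_differentiable times_differentiable_affine)

lemma smooth_DERIV: "smooth f \<Longrightarrow> (f has_real_derivative deriv f x) (at x)"
  using times_differentiable_SucD(1)[of 0] by (simp add: smooth_iff_times_differentiable del: times_differentiable.simps)

lemma smooth_deriv: "smooth f \<Longrightarrow> smooth (deriv f)"
  using times_differentiable_SucD(2) by (simp add: smooth_iff_times_differentiable del: times_differentiable.simps)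

lemma smooth_isCont: "smooth f \<Longrightarrow> isCont f x"
  using smooth_DERIV DERIV_isCont by blast

lemma smooth_continuous_on: "smooth f \<Longrightarrow> continuous_on S f"
  by (simp add: smooth_isCont continuous_at_imp_continuous_on)

lemma smooth_borel_measurable: "smooth f \<Longrightarrow> f \<in> borel_measurable borel"
  by (simp add: smooth_continuous_on borel_measurable_continuous_onI)

section \<open>A smooth monotone transition from 0 to 1\<close>

text \<open>The negative powers make the span of the family closed under differentiation, so that
  smoothness follows by induction.\<close>

definition flat_exp :: "nat \<Rightarrow> real \<Rightarrow> real" where
  "flat_exp k t = (if t > 0 then exp (- (1 / t)) / t ^ k else 0)"

lemma flat_exp_nonneg: "0 \<le> flat_exp k t"
  by (simp add: flat_exp_def)

text \<open>For t > 0 the exponential series at 1/t dominates its single term of order k + 2. The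
  two surplus powers give quadratic decay at 0, so the difference quotient there is O(|h|).\<close>

lemma flat_exp_le: "flat_exp k t \<le> fact (k + 2) * t\<^sup>2"
proof (cases "t > 0")
  case True
  have "(1 / t) ^ (k + 2) / fact (k + 2) \<le> exp (1 / t)"
    using sum_le_suminf[OF summable_exp[of "1/t"], of "{k + 2}"] True
    by (simp add: exp_def scaleR_conv_of_real field_simps summable_exp)
  then show ?thesis
    using True by (simp add: flat_exp_def exp_minus divide_simps power_add power2_eq_square mult_ac)
qed (simp add: flat_exp_def)

lemma flat_exp_DERIV:
  "(flat_exp k has_real_derivative flat_exp (k + 2) t - real k * flat_exp (k + 1) t) (at t)"
proof -
  consider "t < 0" | "t > 0" | "t = 0" by linarith
  then show ?thesis
  proof cases
    case 1
    have "((\<lambda>t. 0) has_real_derivative flat_exp (k + 2) t - real k * flat_exp (k + 1) t) (at t)"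
      using 1 by (simp add: flat_exp_def)
    then show ?thesis
      by (rule has_field_derivative_transform_within_open[where S="{..<0}"])
        (use 1 in \<open>auto simp: flat_exp_def\<close>)
  next
    case 2
    have k: "real k * t ^ (k - Suc 0) = real k * t ^ k / t"
      using 2 by (cases k) auto
    have "((\<lambda>t. exp (- (1 / t)) / t ^ k) has_real_derivative
        (exp (- (1 / t)) / t\<^sup>2 * t ^ k - exp (- (1 / t)) * (real k * t ^ (k - Suc 0)))
          / (t ^ k * t ^ k)) (at t)"
      using 2 by (auto intro!: derivative_eq_intros simp: power2_eq_square)
    also have "(exp (- (1 / t)) / t\<^sup>2 * t ^ k - exp (- (1 / t)) * (real k * t ^ (k - Suc 0)))
          / (t ^ k * t ^ k) = flat_exp (k + 2) t - real k * flat_exp (k + 1) t"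
      unfolding k using 2 by (simp add: flat_exp_def field_simps power2_eq_square)
    finally have "((\<lambda>t. exp (- (1 / t)) / t ^ k) has_real_derivative
        flat_exp (k + 2) t - real k * flat_exp (k + 1) t) (at t)" .
    then show ?thesis
      by (rule has_field_derivative_transform_within_open[where S="{0<..}"])
        (use 2 in \<open>auto simp: flat_exp_def field_simps\<close>)
  next
    case 3
    have "((\<lambda>h. flat_exp k h / h) \<longlongrightarrow> 0) (at 0)"
    proof (rule tendsto_rabs_zero_cancel,
        rule tendsto_sandwich[where f="\<lambda>_. 0" and h="\<lambda>h. fact (k + 2) * \<bar>h\<bar>"])
      show "\<forall>\<^sub>F h in at 0. \<bar>flat_exp k h / h\<bar> \<le> fact (k + 2) * \<bar>h\<bar>"
        unfolding eventually_at_filter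
      proof (rule always_eventually, intro allI impI)
        fix h :: real assume "h \<noteq> 0"
        then show "\<bar>flat_exp k h / h\<bar> \<le> fact (k + 2) * \<bar>h\<bar>"
          using flat_exp_le[of k h] flat_exp_nonneg[of k h]
          by (simp add: abs_divide divide_le_eq power2_eq_square mult.assoc)
      qed
      have "((\<lambda>h::real. fact (k + 2) * \<bar>h\<bar>) \<longlongrightarrow> fact (k + 2) * \<bar>0\<bar>) (at 0)"
        by (intro tendsto_intros)
      then show "((\<lambda>h::real. fact (k + 2) * \<bar>h\<bar>) \<longlongrightarrow> 0) (at 0)" by simp
    qed auto
    then show ?thesis
      by (simp add: 3 DERIV_def flat_exp_def[of _ 0])
  qed
qed

lemma times_differentiable_flat_exp: "times_differentiable n (flat_exp k)"
proof (induction n arbitrary: k)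
  case (Suc n)
  show ?case
    by (rule times_differentiable_SucI[OF flat_exp_DERIV])
      (intro times_differentiable_diff times_differentiable_cmult Suc.IH)
qed simp

text \<open>The standard transition built from exp(-1/t). Since \<open>t\<close> and
  \<open>1 - t\<close> are never both nonpositive, the inverted sum is positive.\<close>

definition step :: "real \<Rightarrow> real" where
  "step t = flat_exp 0 t * inverse (flat_exp 0 t + flat_exp 0 (1 - t))"

lemma flat_exp_denom_pos: "0 < flat_exp 0 t + flat_exp 0 (1 - t)"
  by (auto simp: flat_exp_def add_pos_pos)

lemma smooth_step: "smooth step"
  unfolding smooth_iff_times_differentiable
proof
  fix n
  have "times_differentiable n (\<lambda>t. flat_exp 0 (1 - t))"
    using times_differentiable_affine[OF times_differentiable_flat_exp, of n 0 "-1" 1] by simp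
  then show "times_differentiable n step"
    unfolding step_def[abs_def]
    by (intro times_differentiable_mult times_differentiable_inverse times_differentiable_add
        times_differentiable_flat_exp) (use flat_exp_denom_pos in \<open>metis less_irrefl\<close>)+
qed

lemma step_eq_0: "t \<le> 0 \<Longrightarrow> step t = 0"
  by (simp add: step_def flat_exp_def)

lemma step_eq_1: "1 \<le> t \<Longrightarrow> step t = 1"
  by (simp add: step_def flat_exp_def)

text \<open>Clearing denominators cancels a common product. What remains compares two products
  factor by factor, and each factor is monotone because exp(-1/t) is.\<close>

lemma step_mono: "s \<le> t \<Longrightarrow> step s \<le> step t"
proof -
  have m: "flat_exp 0 s \<le> flat_exp 0 t" if "s \<le> t" for s t
    using that by (auto simp: flat_exp_def frac_le)
  assume "s \<le> t"
  then have "flat_exp 0 s * flat_exp 0 (1 - t) \<le> flat_exp 0 t * flat_exp 0 (1 - s)"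
    by (intro mult_mono m flat_exp_nonneg) auto
  then show "step s \<le> step t"
    using flat_exp_denom_pos[of s] flat_exp_denom_pos[of t]
    by (simp add: step_def divide_inverse[symmetric] frac_le_eq field_simps)
qed

lemma step_bounds: "0 \<le> step t" "step t \<le> 1"
  using step_mono[of "min t 0" t] step_eq_0[of "min t 0"]
    step_mono[of t "max t 1"] step_eq_1[of "max t 1"] by auto

lemma deriv_step_nonneg: "0 \<le> deriv step t"
  by (rule mono_on_imp_deriv_nonneg[where A=UNIV, OF _ smooth_DERIV[OF smooth_step]])
    (auto intro: mono_onI step_mono)

text \<open>Outside the open unit interval the transition sits at its global minimum 0 or maximum 1.
  Fermat's criterion then covers the endpoints as well.\<close>

lemma deriv_step_eq_0: "t \<notin> {0<..<1} \<Longrightarrow> deriv step t = 0"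
proof -
  assume t: "t \<notin> {0<..<1}"
  have "t \<le> 0 \<or> 1 \<le> t" using t by auto
  then show ?thesis
  proof
    assume "t \<le> 0"
    then have "step t \<le> step s" for s by (simp add: step_eq_0 step_bounds)
    then show ?thesis
      by (intro DERIV_local_min[OF smooth_DERIV[OF smooth_step], of 1]) auto
  next
    assume "1 \<le> t"
    then have "step s \<le> step t" for s by (simp add: step_eq_1 step_bounds)
    then show ?thesis
      by (intro DERIV_local_max[OF smooth_DERIV[OF smooth_step], of 1]) auto
  qed
qed

section \<open>Compact supports and plateau functions\<close>

lemma
  assumes "{x. f x \<noteq> 0} \<subseteq> {a..b}"
  shows supp_subset_Icc: "supp f \<subseteq> {a..b}" and compact_supp: "compact (supp f)"
proof -
  show s: "supp f \<subseteq> {a..b}"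
    unfolding supp_def by (rule closure_minimal) (use assms in simp_all)
  show "compact (supp f)"
    using bounded_subset[OF bounded_closed_interval s] by (simp add: compact_eq_bounded_closed supp_def)
qed

text \<open>For x + h <= y and positive widths this rises over [x, x + h] and falls over [y, y + k].
  Two independent widths allow two uses: test functions approximating the indicator of a half-line
  (left width tending to 0, right width 1), and energy competitors with equal widths.\<close>

definition plateau :: "real \<Rightarrow> real \<Rightarrow> real \<Rightarrow> real \<Rightarrow> real \<Rightarrow> real" where
  "plateau x h y k r = step ((r - x) / h) - step ((r - y) / k)"

lemma smooth_plateau: "smooth (plateau x h y k)"
proof -
  have "smooth (\<lambda>r. step ((r - c) / d))" for c d
    using smooth_affine[OF smooth_step, of "1 / d" "- (c / d)"] by (simp add: diff_divide_distrib)
  then show ?thesis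
    unfolding plateau_def[abs_def] by (intro smooth_diff)
qed

text \<open>The absolute value allows for the falling ramp lying left of the rising one, as happens
  for early members of the half-line approximation.\<close>

lemma abs_plateau_le_1: "\<bar>plateau x h y k r\<bar> \<le> 1"
  using step_bounds[of "(r - x) / h"] step_bounds[of "(r - y) / k"] by (auto simp: plateau_def)

lemma plateau_support:
  assumes "0 < h" "0 < k"
  shows "{r. plateau x h y k r \<noteq> 0} \<subseteq> {min x y..max (x + h) (y + k)}"
proof (rule subsetI, rule ccontr)
  fix r assume r: "r \<in> {r. plateau x h y k r \<noteq> 0}" "r \<notin> {min x y..max (x + h) (y + k)}"
  consider "r < x" "r < y" | "x + h < r" "y + k < r"
    using r(2) by fastforce
  then have "plateau x h y k r = 0"
    by cases (use assms in \<open>auto simp: plateau_def step_eq_0 step_eq_1 divide_le_0_iff le_divide_eq\<close>)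
  then show False using r by simp
qed

lemma test_function_plateau: "0 < h \<Longrightarrow> 0 < k \<Longrightarrow> test_function (plateau x h y k)"
  unfolding test_function_def using smooth_plateau compact_supp[OF plateau_support] by blast

section \<open>Uniqueness of the Jordan decomposition of the distributional derivative\<close>

lemma finite_borel_measureD:
  assumes "finite_borel_measure \<mu>"
  shows "finite_measure \<mu>" "sets \<mu> = sets borel" "space \<mu> = UNIV"
  using assms sets_eq_imp_space_eq[of \<mu> borel] by (auto simp: finite_borel_measure_def)

text \<open>At each point the sequence is eventually equal to its limit: once n is large, the
  descent starts beyond \<open>r\<close>, and for r > x the rising ramp is already completed before
  \<open>r\<close>.\<close>

lemma plateau_tendsto_indicator:
  "(\<lambda>n. plateau x (inverse (Suc n)) (real n) 1 r) \<longlonglongrightarrow> indicator {x<..} r"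
proof -
  obtain N where N: "1 / (r - x) < real N" "r < real N"
    using reals_Archimedean2[of "max (1 / (r - x)) r"] by auto
  have "plateau x (inverse (Suc n)) (real n) 1 r = indicator {x<..} r" if "n \<ge> N" for n
  proof -
    have n: "1 / (r - x) < real n" "r < real n" using N that by linarith+
    have "step ((r - x) / inverse (Suc n)) = indicator {x<..} r"
    proof (cases "x < r")
      case True
      then have "1 \<le> (r - x) * real (Suc n)"
        using n by (simp add: divide_less_eq algebra_simps)
      then show ?thesis using True step_eq_1 by (simp add: divide_inverse)
    qed (simp add: step_eq_0 mult_nonpos_nonneg divide_inverse)
    then show ?thesis using n by (simp add: plateau_def step_eq_0)
  qed
  then show ?thesis
    by (intro tendsto_eventually) (auto simp: eventually_sequentially)
qed

lemma integral_plateau_tendsto_measure: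
  assumes "finite_borel_measure \<mu>"
  shows "(\<lambda>n. LINT r|\<mu>. plateau x (inverse (Suc n)) (real n) 1 r) \<longlonglongrightarrow> measure \<mu> {x<..}"
proof -
  note [simp] = finite_borel_measureD[OF assms]
  have [measurable_cong]: "sets \<mu> = sets borel" by simp
  have [measurable]: "plateau x' h y k \<in> borel_measurable borel" for x' h y k
    by (intro smooth_borel_measurable smooth_plateau)
  have "(\<lambda>n. LINT r|\<mu>. plateau x (inverse (Suc n)) (real n) 1 r)
      \<longlonglongrightarrow> (LINT r|\<mu>. indicator {x<..} r)"
    by (rule integral_dominated_convergence[where w="\<lambda>_. 1"])
      (auto intro!: finite_measure.integrable_const always_eventually plateau_tendsto_indicator
        simp: abs_plateau_le_1 simp del: of_nat_Suc)
  then show ?thesis by simp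
qed

text \<open>The distribution Du determines the signed measure. Plateau test functions give equality
  on open right half-lines by dominated convergence. These form a generator stable under
  intersection, and a Dynkin-class induction extends equality to all Borel sets. Real-valued
  \<open>measure\<close> is used so that differences make sense.\<close>

lemma derivative_measures_agree:
  assumes "has_derivative_measure u \<mu> \<nu>" "has_derivative_measure u \<mu>' \<nu>'" "E \<in> sets borel"
  shows "measure \<mu> E - measure \<nu> E = measure \<mu>' E - measure \<nu>' E"
proof -
  have fin: "finite_borel_measure \<mu>" "finite_borel_measure \<nu>"
    "finite_borel_measure \<mu>'" "finite_borel_measure \<nu>'"
    using assms by (auto simp: has_derivative_measure_def)
  let ?D = "\<lambda>E. measure \<mu> E - measure \<nu> E" and ?D' = "\<lambda>E. measure \<mu>' E - measure \<nu>' E"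
  have Ioi: "?D {x<..} = ?D' {x<..}" for x
  proof (rule LIMSEQ_unique)
    let ?w = "\<lambda>n. plateau x (inverse (Suc n)) (real n) 1"
    show "(\<lambda>n. (LINT r|\<mu>. ?w n r) - (LINT r|\<nu>. ?w n r)) \<longlonglongrightarrow> ?D {x<..}"
      by (intro tendsto_diff integral_plateau_tendsto_measure fin)
    have "(LINT r|\<mu>. ?w n r) - (LINT r|\<nu>. ?w n r) = (LINT r|\<mu>'. ?w n r) - (LINT r|\<nu>'. ?w n r)" for n
    proof -
      have "test_function (?w n)" by (rule test_function_plateau) simp_all
      then show ?thesis
        using assms(1,2) unfolding has_derivative_measure_def by (metis neg_equal_iff_equal)
    qed
    then show "(\<lambda>n. (LINT r|\<mu>. ?w n r) - (LINT r|\<nu>. ?w n r)) \<longlonglongrightarrow> ?D' {x<..}"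
      by (simp only:) (intro tendsto_diff integral_plateau_tendsto_measure fin)
  qed
  have lim: "(\<lambda>n. measure M {- real n<..}) \<longlonglongrightarrow> measure M UNIV" if "finite_borel_measure M" for M
  proof -
    have "(\<Union>n. {- real n<..}) = UNIV"
      using reals_Archimedean2[of "- x" for x] by (fastforce simp: minus_less_iff)
    moreover have "incseq (\<lambda>n. {- real n<..})" by (auto simp: incseq_def)
    moreover have "range (\<lambda>n. {- real n<..}) \<subseteq> sets borel" by auto
    ultimately show ?thesis
      using finite_measure.finite_Lim_measure_incseq[OF finite_borel_measureD(1)[OF that],
          of "\<lambda>n. {- real n<..}"] finite_borel_measureD(2)[OF that] by auto
  qed
  \<comment> \<open>The complement step needs equal total masses, and the whole line is not itself
    an open half-line. It is exhausted by the half-lines starting at -n.\<close>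
  have univ: "?D UNIV = ?D' UNIV"
  proof (rule LIMSEQ_unique)
    show "(\<lambda>n. ?D {- real n<..}) \<longlonglongrightarrow> ?D UNIV" by (intro tendsto_diff lim fin)
    show "(\<lambda>n. ?D {- real n<..}) \<longlonglongrightarrow> ?D' UNIV"
      unfolding Ioi by (intro tendsto_diff lim fin)
  qed
  have s: "sets (borel :: real measure) = sigma_sets UNIV (range greaterThan)"
    unfolding borel_Ioi by (simp add: sets_measure_of)
  have "Int_stable (range (greaterThan :: real \<Rightarrow> real set))"
  proof -
    have "{a<..} \<inter> {b<..} = {max a b<..}" for a b :: real by auto
    then show ?thesis by (auto simp: Int_stable_def)
  qed
  moreover have "range (greaterThan :: real \<Rightarrow> real set) \<subseteq> Pow UNIV" by auto
  moreover have "E \<in> sigma_sets UNIV (range greaterThan)" using assms(3) s by simp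
  ultimately show ?thesis
  proof (induction rule: sigma_sets_induct_disjoint)
    case (compl E)
    then have E: "E \<in> sets borel" by (simp add: s)
    have "measure M (UNIV - E) = measure M UNIV - measure M E" if "finite_borel_measure M" for M
      using finite_measure.finite_measure_compl[OF finite_borel_measureD(1)[OF that], of E] E
        finite_borel_measureD(2,3)[OF that] by simp
    then show ?case using compl.IH univ fin by simp
  next
    case (union E)
    have "(\<lambda>n. measure M (E n)) sums measure M (\<Union>n. E n)" if "finite_borel_measure M" for M
      using finite_measure.finite_measure_UNION[OF finite_borel_measureD(1)[OF that], of E] union.hyps
        finite_borel_measureD(2)[OF that] s by auto
    then have "(\<lambda>n. ?D (E n)) sums ?D (\<Union>n. E n)" "(\<lambda>n. ?D' (E n)) sums ?D' (\<Union>n. E n)"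
      using fin by (auto intro: sums_diff)
    then show ?case
      using union.IH sums_unique2 by simp
  qed (use Ioi in auto)
qed

text \<open>Minimality of the positive part. If \<mu> does not charge S and \<nu> does not charge
  its complement, then \<mu>(E) = \<mu>(E - S) = (\<mu> - \<nu>)(E - S) = (\<mu>' - \<nu>')(E - S)
  <= \<mu>'(E).\<close>

lemma Jordan_positive_part_le:
  assumes "has_derivative_measure u \<mu> \<nu>" "mutually_singular \<mu> \<nu>"
    and "has_derivative_measure u \<mu>' \<nu>'" "E \<in> sets borel"
  shows "emeasure \<mu> E \<le> emeasure \<mu>' E"
proof -
  have fin: "finite_borel_measure \<mu>" "finite_borel_measure \<nu>"
    "finite_borel_measure \<mu>'" "finite_borel_measure \<nu>'"
    using assms by (auto simp: has_derivative_measure_def)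
  note sets = fin[THEN finite_borel_measureD(2)]
  obtain S where S: "S \<in> sets borel" "emeasure \<mu> S = 0" "emeasure \<nu> (- S) = 0"
    using assms(2) by (auto simp: mutually_singular_def)
  have m: "E - S \<in> sets borel" "- S \<in> sets borel" using S assms(4) by auto
  have "emeasure \<nu> (E - S) = 0"
    using emeasure_mono[of "E - S" "- S" \<nu>] S m by (simp add: sets Diff_eq)
  then have "measure \<mu> (E - S) \<le> measure \<mu>' (E - S)"
    using derivative_measures_agree[OF assms(1,3) m(1)] by (simp add: measure_def)
  then have "emeasure \<mu> (E - S) \<le> emeasure \<mu>' (E - S)"
    using fin by (simp add: finite_measure.emeasure_eq_measure finite_borel_measureD)
  also have "\<dots> \<le> emeasure \<mu>' E"
    using assms(4) by (intro emeasure_mono) (auto simp: sets)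
  also have "emeasure \<mu> (E - S) = emeasure \<mu> E"
    using S assms(4) by (intro emeasure_Diff_null_set) (auto simp: sets null_sets_def)
  finally show ?thesis .
qed

text \<open>Two mutually singular representations are each minimal, hence their positive parts
  coincide. Exhibiting one such pair thus resolves the definite description in
  \<open>Du_pos\<close>.\<close>

lemma Du_pos_eqI:
  assumes "has_derivative_measure u \<mu> \<nu>" "mutually_singular \<mu> \<nu>"
  shows "Du_pos u = \<mu>"
  unfolding Du_pos_def
proof (rule the_equality)
  fix \<mu>' assume "\<exists>\<nu>. has_derivative_measure u \<mu>' \<nu> \<and> mutually_singular \<mu>' \<nu>"
  then obtain \<nu>' where *: "has_derivative_measure u \<mu>' \<nu>'" "mutually_singular \<mu>' \<nu>'" by blast
  have s: "sets \<mu>' = sets borel" "sets \<mu> = sets borel"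
    using * assms by (auto simp: has_derivative_measure_def finite_borel_measure_def)
  show "\<mu>' = \<mu>"
    by (rule measure_eqI)
      (auto simp: s intro: antisym Jordan_positive_part_le[OF * assms(1)] Jordan_positive_part_le[OF assms *(1)])
qed (use assms in blast)

section \<open>Derivative measure and energy of smooth compactly supported functions\<close>

lemma has_bochner_integral_derivative:
  fixes F f :: "real \<Rightarrow> real"
  assumes F: "\<And>x. (F has_real_derivative f x) (at x)" and f: "continuous_on UNIV f"
    and "a \<le> b" and 0: "{x. f x \<noteq> 0} \<subseteq> {a..b}"
  shows "has_bochner_integral lborel f (F b - F a)"
proof -
  have "has_bochner_integral lborel (\<lambda>x. f x * indicator {a..b} x) (F b - F a)"
    using f by (intro has_bochner_integral_FTC_Icc_real F \<open>a \<le> b\<close>) (simp add: continuous_on_eq_continuous_at)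
  also have "(\<lambda>x. f x * indicator {a..b} x) = f"
    using 0 by (fastforce simp: indicator_def fun_eq_iff)
  finally show ?thesis .
qed

lemma integrable_continuous_compact_support:
  fixes f :: "real \<Rightarrow> real"
  assumes f: "continuous_on UNIV f" and 0: "{x. f x \<noteq> 0} \<subseteq> {a..b}"
  shows "integrable lborel f"
proof -
  have "set_integrable lborel {a..b} f"
    by (rule borel_integrable_atLeastAtMost') (rule continuous_on_subset[OF f], simp)
  moreover have "(\<lambda>x. indicator {a..b} x *\<^sub>R f x) = f"
    using 0 by (fastforce simp: indicator_def fun_eq_iff)
  ultimately show ?thesis by (simp add: set_integrable_def)
qed

lemma deriv_eq_0_outside:
  fixes f :: "real \<Rightarrow> real"
  assumes "{x. f x \<noteq> 0} \<subseteq> {a..b}" and "x \<notin> {a..b}"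
  shows "deriv f x = 0"
proof (rule DERIV_imp_deriv)
  show "(f has_real_derivative 0) (at x)"
    by (rule has_field_derivative_transform_within_open[where S="- {a..b}" and f="\<lambda>_. 0"])
      (use assms in \<open>auto\<close>)
qed

lemma deriv_support_subset:
  fixes f :: "real \<Rightarrow> real"
  shows "{x. f x \<noteq> 0} \<subseteq> {a..b} \<Longrightarrow> {x. deriv f x \<noteq> 0} \<subseteq> {a..b}"
  using deriv_eq_0_outside by blast

lemma finite_borel_measure_density:
  assumes "integrable lborel f" "\<And>x. 0 \<le> f x"
  shows "finite_borel_measure (density lborel (\<lambda>x. ennreal (f x)))"
proof -
  have "emeasure (density lborel (\<lambda>x. ennreal (f x))) UNIV = (\<integral>\<^sup>+x. ennreal (f x) \<partial>lborel)"
    using borel_measurable_integrable[OF assms(1)] by (subst emeasure_density) auto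
  also have "\<dots> = ennreal (LINT x|lborel. f x)"
    using assms by (intro nn_integral_eq_integral) auto
  finally show ?thesis
    unfolding finite_borel_measure_def by (auto intro!: finite_measureI)
qed

context
  fixes u :: "real \<Rightarrow> real" and a b :: real
  assumes u: "smooth u" and u0: "{x. u x \<noteq> 0} \<subseteq> {a..b}"
begin

lemma continuous_deriv_parts:
  "continuous_on UNIV (deriv u)"
  "continuous_on UNIV (\<lambda>x. max (deriv u x) 0)" "continuous_on UNIV (\<lambda>x. max (- deriv u x) 0)"
  using smooth_continuous_on[OF smooth_deriv[OF u], of UNIV] by (auto intro!: continuous_intros)

lemma integrable_deriv_parts:
  "integrable lborel (\<lambda>x. max (deriv u x) 0)" "integrable lborel (\<lambda>x. max (- deriv u x) 0)"
  using deriv_support_subset[OF u0]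
  by (intro integrable_continuous_compact_support[of _ a b] continuous_deriv_parts; force)+

text \<open>Integration by parts: the integral of (u \<phi>)' vanishes because \<open>u\<close> has
  compact support, and \<open>deriv u\<close> splits into its positive and negative parts.\<close>

lemma smooth_has_derivative_measure:
  "has_derivative_measure u (density lborel (\<lambda>x. ennreal (max (deriv u x) 0)))
     (density lborel (\<lambda>x. ennreal (max (- deriv u x) 0)))"
  unfolding has_derivative_measure_def
proof (intro conjI allI impI)
  show "finite_borel_measure (density lborel (\<lambda>x. ennreal (max (deriv u x) 0)))"
    "finite_borel_measure (density lborel (\<lambda>x. ennreal (max (- deriv u x) 0)))"
    by (rule finite_borel_measure_density[OF integrable_deriv_parts(1)], simp)
      (rule finite_borel_measure_density[OF integrable_deriv_parts(2)], simp)
  fix \<phi> assume "test_function \<phi>"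
  then have \<phi>: "smooth \<phi>" by (simp add: test_function_def)
  note [continuous_intros] = smooth_continuous_on[OF u] smooth_continuous_on[OF \<phi>]
    smooth_continuous_on[OF smooth_deriv[OF \<phi>]] continuous_deriv_parts
  note u'0 = deriv_support_subset[OF u0]
  have I: "integrable lborel (\<lambda>x. u x * deriv \<phi> x)"
    "integrable lborel (\<lambda>x. max (deriv u x) 0 * \<phi> x)"
    "integrable lborel (\<lambda>x. max (- deriv u x) 0 * \<phi> x)"
    using u0 u'0
    by (intro integrable_continuous_compact_support[of _ a b] continuous_intros; force)+
  \<comment> \<open>The interval is enlarged so that \<open>u\<close> vanishes at both ends;
    \<open>min\<close> and \<open>max\<close> also cover the case a > b, where \<open>u\<close> is
    identically zero.\<close>
  define c d where "c = min a b - 1" and "d = max a b + 1"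
  have "has_bochner_integral lborel (\<lambda>x. u x * deriv \<phi> x + deriv u x * \<phi> x) (u d * \<phi> d - u c * \<phi> c)"
  proof (rule has_bochner_integral_derivative[where F="\<lambda>x. u x * \<phi> x" and a=c and b=d])
    show "((\<lambda>x. u x * \<phi> x) has_real_derivative u x * deriv \<phi> x + deriv u x * \<phi> x) (at x)" for x
      by (rule DERIV_cong[OF DERIV_mult[OF smooth_DERIV[OF u] smooth_DERIV[OF \<phi>]]]) simp
    show "{x. u x * deriv \<phi> x + deriv u x * \<phi> x \<noteq> 0} \<subseteq> {c..d}"
    proof (rule subset_trans)
      show "{x. u x * deriv \<phi> x + deriv u x * \<phi> x \<noteq> 0} \<subseteq> {a..b}"
        using u0 u'0 by force
    qed (auto simp: c_def d_def)
  qed (auto simp: c_def d_def intro!: continuous_intros)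
  also have "u d * \<phi> d - u c * \<phi> c = 0"
  proof -
    have "c \<notin> {a..b}" "d \<notin> {a..b}" by (auto simp: c_def d_def)
    then have "u c = 0" "u d = 0" using u0 by blast+
    then show ?thesis by simp
  qed
  finally have "0 = (LINT x|lborel. u x * deriv \<phi> x + deriv u x * \<phi> x)"
    by (simp add: has_bochner_integral_integral_eq)
  also have "\<dots> = (LINT x|lborel. u x * deriv \<phi> x
      + (max (deriv u x) 0 * \<phi> x - max (- deriv u x) 0 * \<phi> x))"
    by (intro Bochner_Integration.integral_cong) (auto simp: max_def)
  also have "\<dots> = (LINT x|lborel. u x * deriv \<phi> x)
      + ((LINT x|lborel. max (deriv u x) 0 * \<phi> x) - (LINT x|lborel. max (- deriv u x) 0 * \<phi> x))"
    using I by simp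
  finally show "(LINT x|lborel. u x * deriv \<phi> x) =
      - ((LINT x|density lborel (\<lambda>x. ennreal (max (deriv u x) 0)). \<phi> x)
       - (LINT x|density lborel (\<lambda>x. ennreal (max (- deriv u x) 0)). \<phi> x))"
    using continuous_deriv_parts smooth_borel_measurable[OF \<phi>]
    by (subst (1 2) integral_real_density) (auto intro: borel_measurable_continuous_onI)
qed

text \<open>The set where \<open>deriv u\<close> is nonpositive separates the two densities.\<close>

lemma Du_pos_smooth: "Du_pos u = density lborel (\<lambda>x. ennreal (max (deriv u x) 0))"
proof (rule Du_pos_eqI[OF smooth_has_derivative_measure])
  note [measurable] = continuous_deriv_parts[THEN borel_measurable_continuous_onI]
  let ?S = "{x \<in> space borel. deriv u x \<le> 0}"
  show "mutually_singular (density lborel (\<lambda>x. ennreal (max (deriv u x) 0)))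
     (density lborel (\<lambda>x. ennreal (max (- deriv u x) 0)))"
    unfolding mutually_singular_def
  proof (intro bexI conjI)
    show S: "?S \<in> sets borel" by measurable
    have "emeasure (density lborel (\<lambda>x. ennreal (max (deriv u x) 0))) ?S
        = (\<integral>\<^sup>+x. ennreal (max (deriv u x) 0) * indicator ?S x \<partial>lborel)"
      by (rule emeasure_density) (use S in auto)
    also have "\<dots> = (\<integral>\<^sup>+x. 0 \<partial>(lborel :: real measure))"
      by (intro nn_integral_cong) (auto simp: indicator_def max_def)
    finally show "emeasure (density lborel (\<lambda>x. ennreal (max (deriv u x) 0))) ?S = 0" by simp
    have "emeasure (density lborel (\<lambda>x. ennreal (max (- deriv u x) 0))) (- ?S)
        = (\<integral>\<^sup>+x. ennreal (max (- deriv u x) 0) * indicator (- ?S) x \<partial>lborel)"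
      by (rule emeasure_density) (use S in auto)
    also have "\<dots> = (\<integral>\<^sup>+x. 0 \<partial>(lborel :: real measure))"
      by (intro nn_integral_cong) (auto simp: indicator_def max_def)
    finally show "emeasure (density lborel (\<lambda>x. ennreal (max (- deriv u x) 0))) (- ?S) = 0" by simp
  qed
qed

lemma smooth_in_BV: "u \<in> BV"
  unfolding BV_def
  using smooth_has_derivative_measure integrable_continuous_compact_support[OF smooth_continuous_on[OF u] u0]
  by blast

end

lemma A_smooth_subset_A_BV: "A_smooth R1 R2 \<subseteq> A_BV R1 R2"
proof
  fix u assume u: "u \<in> A_smooth R1 R2"
  have "{x. u x \<noteq> 0} \<subseteq> supp u" unfolding supp_def by (rule closure_subset)
  also have "supp u \<subseteq> {R1..R2}" using u by (force simp: A_smooth_def)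
  finally have "{x. u x \<noteq> 0} \<subseteq> {R1..R2}" .
  then show "u \<in> A_BV R1 R2"
    using u smooth_in_BV[of u R1 R2] unfolding A_smooth_def A_BV_def by (auto intro!: always_eventually)
qed

text \<open>Passing to the density turns the energy into a Lebesgue integral over the whole line;
  the restriction to [R1, R2] disappears because \<open>deriv u\<close> vanishes outside it.\<close>

lemma J_smooth:
  assumes "smooth u" "{x. u x \<noteq> 0} \<subseteq> {R1..R2}" "F_fn M1 M2 R1 u \<in> borel_measurable borel"
  shows "J M1 M2 R1 R2 u =
    (LINT r|lborel. max (deriv u r) 0 * (r ^ 3 / sqrt (F_fn M1 M2 R1 u r)))"
proof -
  note [measurable] = assms(3) continuous_deriv_parts[OF assms(1,2), THEN borel_measurable_continuous_onI]
  have "J M1 M2 R1 R2 u = (LINT r|lborel. max (deriv u r) 0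
      * (indicator {R1..R2} r *\<^sub>R (r ^ 3 / sqrt (F_fn M1 M2 R1 u r))))"
    unfolding J_def set_lebesgue_integral_def Du_pos_smooth[OF assms(1,2)]
    by (rule integral_real_density) auto
  also have "\<dots> = (LINT r|lborel. max (deriv u r) 0 * (r ^ 3 / sqrt (F_fn M1 M2 R1 u r)))"
    by (intro Bochner_Integration.integral_cong)
      (auto split: split_indicator simp: deriv_eq_0_outside[OF assms(2)])
  finally show ?thesis .
qed

section \<open>The critical radius and the growth of \<open>Psi\<close> to the right of the optimal
  radius\<close>

definition critical_cubic :: "real \<Rightarrow> real \<Rightarrow> real \<Rightarrow> real" where
  "critical_cubic M1 R2 x = M1 * x ^ 3 + 3 * R2 ^ 3 * x - 7 * M1 * R2 ^ 3"

lemma critical_cubic_less: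
  assumes "0 < M1" "0 < R2" "x < y"
  shows "critical_cubic M1 R2 x < critical_cubic M1 R2 y"
proof -
  have "x ^ 3 \<le> y ^ 3" using assms(3) by (intro power_mono_odd) auto
  then have "M1 * x ^ 3 \<le> M1 * y ^ 3" "R2 ^ 3 * x < R2 ^ 3 * y"
    using assms by simp_all
  then show ?thesis by (simp add: critical_cubic_def)
qed

text \<open>Existence comes from a sign change on [0, R2], uniqueness from strict monotonicity. The
  value at \<open>R2\<close> factors as 3 R2^3 (R2 - 2 M1) > 0, which places the root strictly left
  of \<open>R2\<close>.\<close>

lemma
  assumes "0 < M1" "2 * M1 < R2"
  shows critical_cubic_x0: "critical_cubic M1 R2 (x0 M1 R2) = 0" and x0_less: "x0 M1 R2 < R2"
proof -
  have R2: "0 < R2" using assms by simp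
  have pos: "0 < critical_cubic M1 R2 R2"
  proof -
    have "critical_cubic M1 R2 R2 = 3 * R2 ^ 3 * (R2 - 2 * M1)"
      by (simp add: critical_cubic_def algebra_simps)
    then show ?thesis using assms R2 by simp
  qed
  have "critical_cubic M1 R2 0 \<le> 0" using assms R2 by (simp add: critical_cubic_def)
  then have "\<exists>x\<ge>0. x \<le> R2 \<and> critical_cubic M1 R2 x = 0"
    using pos R2 by (intro IVT) (auto simp: critical_cubic_def intro!: continuous_intros)
  then obtain x where x: "critical_cubic M1 R2 x = 0" by blast
  have "x0 M1 R2 = x"
    unfolding x0_def critical_cubic_def[symmetric]
    using x critical_cubic_less[OF assms(1) R2] by (intro the_equality) (auto, metis less_irrefl linorder_neqE)
  then show *: "critical_cubic M1 R2 (x0 M1 R2) = 0" using x by simp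
  show "x0 M1 R2 < R2"
    using * pos critical_cubic_less[OF assms(1) R2, of R2 "x0 M1 R2"]
    by (metis less_asym less_irrefl linorder_neqE)
qed

lemma Psi_DERIV:
  assumes "0 < M1" "2 * M1 < r" "r < R2"
  shows "(Psi M1 R2 has_real_derivative
    Psi M1 R2 r / (r * (r - 2 * M1) * (R2 ^ 3 - r ^ 3)) * critical_cubic M1 R2 r) (at r)"
proof -
  have A: "0 < R2 ^ 3 - r ^ 3" using assms by (simp add: power_strict_mono)
  define s where "s = sqrt (r - 2 * M1)"
  have s: "0 < s" "r = s\<^sup>2 + 2 * M1" using assms by (auto simp: s_def)
  have pw: "r powr (5 / 2) = r powr (7 / 2) / r"
    using assms powr_diff[of r "7/2" 1] by simp
  have d: "((\<lambda>r. r powr (7/2)) has_real_derivative 7 / 2 * r powr (5 / 2)) (at r)"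
    "((\<lambda>r. sqrt (r - 2 * M1)) has_real_derivative 1 / (2 * s)) (at r)"
    "((\<lambda>r. (R2 ^ 3 - r ^ 3) / 3) has_real_derivative - r\<^sup>2) (at r)"
    using assms by (auto intro!: derivative_eq_intros simp: s_def field_simps)
  have "((\<lambda>r. r powr (7/2) / sqrt (r - 2 * M1) / ((R2 ^ 3 - r ^ 3) / 3)) has_real_derivative
     ((7 / 2 * r powr (5 / 2) * s - r powr (7/2) * (1 / (2 * s))) / (s * s) * ((R2 ^ 3 - r ^ 3) / 3)
       - r powr (7/2) / s * (- r\<^sup>2)) / ((R2 ^ 3 - r ^ 3) / 3 * ((R2 ^ 3 - r ^ 3) / 3))) (at r)"
  proof -
    have "sqrt (r - 2 * M1) \<noteq> 0" "(R2 ^ 3 - r ^ 3) / 3 \<noteq> 0" using assms A by auto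
    from DERIV_divide[OF DERIV_divide[OF d(1,2) this(1)] d(3) this(2)] show ?thesis
      unfolding s_def[symmetric] .
  qed
  also have "((7 / 2 * r powr (5 / 2) * s - r powr (7/2) * (1 / (2 * s))) / (s * s) * ((R2 ^ 3 - r ^ 3) / 3)
       - r powr (7/2) / s * (- r\<^sup>2)) / ((R2 ^ 3 - r ^ 3) / 3 * ((R2 ^ 3 - r ^ 3) / 3))
     = Psi M1 R2 r / (r * (r - 2 * M1) * (R2 ^ 3 - r ^ 3)) * critical_cubic M1 R2 r"
  proof -
    \<comment> \<open>Writing \<open>M1\<close> through r and s removes the square root; the claim
      becomes a polynomial identity after clearing denominators.\<close>
    have rs: "r - 2 * M1 = s\<^sup>2" "M1 = (r - s\<^sup>2) / 2" using s by auto
    show ?thesis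
      unfolding Psi_def q_fn_def A_fn_def s_def[symmetric] pw critical_cubic_def
      unfolding rs(1) unfolding rs(2)
      using A assms s(1) by (simp add: divide_simps) algebra
  qed
  finally show ?thesis
    by (simp add: Psi_def[abs_def] q_fn_def A_fn_def)
qed

text \<open>By the mean value theorem the increment is e times a positive factor times the cubic at
  an intermediate point. Ending at the midpoint of a and \<open>R2\<close> keeps that factor
  bounded, and the Lipschitz bound on the cubic gives the shape g(a) e + e^2. This serves both
  regimes: it is linear in general and quadratic when g(a) = 0.\<close>

lemma Psi_increment:
  assumes "0 < M1" "2 * M1 < a" "a < R2" "0 \<le> critical_cubic M1 R2 a"
  shows "\<exists>K\<ge>0. \<forall>e>0. a + e \<le> (a + R2) / 2 \<longrightarrow> Psi M1 R2 a < Psi M1 R2 (a + e) \<and>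
       Psi M1 R2 (a + e) - Psi M1 R2 a \<le> K * (critical_cubic M1 R2 a * e + e\<^sup>2)"
proof -
  define b where "b = (a + R2) / 2"
  have b: "a < b" "b < R2" using assms by (auto simp: b_def)
  define D where "D r = Psi M1 R2 r / (r * (r - 2 * M1) * (R2 ^ 3 - r ^ 3))" for r
  \<comment> \<open>A Lipschitz constant for the cubic on [a, b]: it bounds the derivative 3 M1 x^2
    + 3 R2^3 for 0 <= x <= R2.\<close>
  define L where "L = 3 * M1 * R2\<^sup>2 + 3 * R2 ^ 3"
  let ?g = "critical_cubic M1 R2"
  have A: "0 < R2 ^ 3 - r ^ 3" if "a \<le> r" "r \<le> b" for r
    using assms b that by (simp add: power_strict_mono)
  have deriv: "(Psi M1 R2 has_real_derivative D r * ?g r) (at r)" if "a \<le> r" "r \<le> b" for r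
    unfolding D_def by (rule Psi_DERIV) (use that assms b in auto)
  have Dpos: "0 < D r" if "a \<le> r" "r \<le> b" for r
    using A[OF that] assms b that by (simp add: D_def Psi_def q_fn_def A_fn_def)
  have "continuous_on {a..b} (Psi M1 R2)"
    using deriv by (intro DERIV_continuous_on) (auto intro: has_field_derivative_at_within)
  then have "continuous_on {a..b} D"
    unfolding D_def using A assms by (intro continuous_intros) force+
  then obtain c where c: "\<And>r. r \<in> {a..b} \<Longrightarrow> D r \<le> D c" "c \<in> {a..b}"
    using continuous_attains_sup[of "{a..b}" D] b by (metis atLeastatMost_empty_iff2 compact_Icc less_imp_le)
  have L: "0 < L" using assms by (auto simp: L_def intro: add_pos_pos)
  have glip: "?g r \<le> ?g a + L * (r - a)" if "a \<le> r" "r \<le> b" for r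
  proof -
    have "r ^ 3 - a ^ 3 = (r - a) * (r\<^sup>2 + r * a + a\<^sup>2)"
      by (simp add: algebra_simps power2_eq_square power3_eq_cube)
    also have "\<dots> \<le> (r - a) * (R2\<^sup>2 + R2 * R2 + R2\<^sup>2)"
      using that assms b by (intro mult_left_mono add_mono mult_mono power_mono) auto
    finally have "M1 * (r ^ 3 - a ^ 3) \<le> M1 * ((r - a) * (3 * R2\<^sup>2))"
      using assms by (intro mult_left_mono) (auto simp: power2_eq_square)
    then show ?thesis by (simp add: critical_cubic_def L_def algebra_simps)
  qed
  have mvt: "\<exists>r. a < r \<and> r < a + e \<and> Psi M1 R2 (a + e) - Psi M1 R2 a = e * (D r * ?g r)"
    if "0 < e" "a + e \<le> b" for e
    using MVT2[of a "a + e" "Psi M1 R2" "\<lambda>r. D r * ?g r"] that deriv by auto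
  show ?thesis
  proof (intro exI[of _ "D c * max 1 L"] conjI allI impI)
    show "0 \<le> D c * max 1 L" using Dpos[of c] c by simp
  next
    fix e assume e: "0 < e" "a + e \<le> (a + R2) / 2"
    then obtain r where r: "a < r" "r < a + e" "Psi M1 R2 (a + e) - Psi M1 R2 a = e * (D r * ?g r)"
      using mvt by (auto simp: b_def)
    have rb: "a \<le> r" "r \<le> b" using r e by (auto simp: b_def)
    have g: "0 < ?g r" using critical_cubic_less[of M1 R2 a r] assms r by auto
    show "Psi M1 R2 a < Psi M1 R2 (a + e)"
      using r(3) g Dpos[OF rb] e by (smt (verit) mult_pos_pos)
    have "?g r \<le> ?g a + L * e"
      using glip[OF rb] r L by (smt (verit) mult_left_mono)
    also have "\<dots> \<le> max 1 L * (?g a + e)"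
    proof -
      have "1 * ?g a \<le> max 1 L * ?g a" "L * e \<le> max 1 L * e"
        using assms e by (intro mult_right_mono; simp)+
      then show ?thesis by (simp add: algebra_simps)
    qed
    finally have "D r * ?g r \<le> D c * (max 1 L * (?g a + e))"
      using c rb Dpos[OF rb] Dpos[of c] g by (intro mult_mono) auto
    then have "e * (D r * ?g r) \<le> e * (D c * (max 1 L * (?g a + e)))"
      using e by (intro mult_left_mono) auto
    then show "Psi M1 R2 (a + e) - Psi M1 R2 a \<le> D c * max 1 L * (?g a * e + e\<^sup>2)"
      unfolding r(3) by (simp add: algebra_simps power2_eq_square)
  qed
qed

section \<open>Mass and energy of normalised plateaus\<close>

context
  fixes u :: "real \<Rightarrow> real" and R1 :: real
  assumes u0: "\<And>r. 0 \<le> u r" and int: "integrable lborel (\<lambda>r. r\<^sup>2 * u r)"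
begin

lemma P_fn_eq: "P_fn R1 u r = (LINT s|lborel. (s\<^sup>2 * u s) * indicator {R1..r} s)"
  by (simp add: P_fn_def set_lebesgue_integral_def mult.commute)

lemma integrable_P_fn: "integrable lborel (\<lambda>s. (s\<^sup>2 * u s) * indicator {R1..r} s)"
  by (rule integrable_real_mult_indicator) (auto intro: int)

lemma P_fn_nonneg: "0 \<le> P_fn R1 u r"
  unfolding P_fn_eq by (rule integral_nonneg_AE) (simp add: u0)

text \<open>The enclosed mass of a nonnegative profile is monotone in the radius, hence
  Borel.\<close>

lemma F_fn_measurable: "F_fn M1 M2 R1 u \<in> borel_measurable borel"
proof -
  have "mono (P_fn R1 u)"
    unfolding mono_def P_fn_eq
    by (intro allI impI integral_mono integrable_P_fn mult_left_mono)
      (auto simp: u0 indicator_def)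
  then have [measurable]: "P_fn R1 u \<in> borel_measurable borel"
    by (rule borel_measurable_mono)
  show ?thesis
    unfolding F_fn_def[abs_def] m_fn_def by measurable
qed

end

lemma
  assumes "a \<le> b"
  shows integrable_square_Icc: "integrable lborel (\<lambda>r::real. r\<^sup>2 * indicator {a..b} r)"
    and integral_square_Icc:
      "(LINT r|lborel. r\<^sup>2 * indicator {a..b} r) = (b ^ 3 - a ^ 3) / (3 :: real)"
proof -
  have "((\<lambda>r. r ^ 3 / 3) has_real_derivative r\<^sup>2) (at r)" for r :: real
    by (auto intro!: derivative_eq_intros)
  then have "has_bochner_integral lborel (\<lambda>r::real. r\<^sup>2 * indicator {a..b} r) (b ^ 3 / 3 - a ^ 3 / 3)"
    using assms by (intro has_bochner_integral_FTC_Icc_real) auto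
  then show "integrable lborel (\<lambda>r::real. r\<^sup>2 * indicator {a..b} r)"
    "(LINT r|lborel. r\<^sup>2 * indicator {a..b} r) = (b ^ 3 - a ^ 3) / (3 :: real)"
    by (auto simp: has_bochner_integral_iff diff_divide_distrib)
qed

text \<open>Because x + h <= y the two ramps do not overlap, so at each point at most one of them
  has nonzero slope. The positive part of the derivative is exactly the slope of the rising
  ramp.\<close>

lemma
  assumes "0 < h" "x + h \<le> y"
  shows plateau_nonneg: "0 \<le> plateau x h y h r"
    and plateau_support_Icc: "{r. plateau x h y h r \<noteq> 0} \<subseteq> {x..y + h}"
    and plateau_le_indicator: "plateau x h y h r \<le> indicator {x..y + h} r"
    and indicator_le_plateau: "indicator {x + h..y} r \<le> plateau x h y h r"
    and deriv_plateau_pos_part: "max (deriv (plateau x h y h) r) 0 = deriv step ((r - x) / h) / h"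
proof -
  show n: "0 \<le> plateau x h y h r" for r
    using assms by (auto simp: plateau_def intro!: step_mono divide_right_mono)
  have *: "plateau x h y h r = 1" if "x + h \<le> r" "r \<le> y" for r
    using assms that by (simp add: plateau_def step_eq_1 step_eq_0 divide_nonpos_pos le_divide_eq)
  show s: "{r. plateau x h y h r \<noteq> 0} \<subseteq> {x..y + h}"
    using plateau_support[of h h x y] assms by (simp add: min_def max_def split: if_splits)
  show "plateau x h y h r \<le> indicator {x..y + h} r"
    using s abs_plateau_le_1[of x h y h r] by (cases "plateau x h y h r = 0") (auto simp: indicator_def)
  show "indicator {x + h..y} r \<le> plateau x h y h r"
    using n * by (auto simp: indicator_def)
  have d: "((\<lambda>r. step ((r - z) / h)) has_real_derivative deriv step ((r - z) / h) / h) (at r)" for z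
    by (rule DERIV_cong[OF DERIV_chain2[where g="\<lambda>r. (r - z) / h", OF smooth_DERIV[OF smooth_step]]])
      (use assms in \<open>auto intro!: derivative_eq_intros\<close>)
  have deriv: "deriv (plateau x h y h) r = deriv step ((r - x) / h) / h - deriv step ((r - y) / h) / h"
    unfolding plateau_def[abs_def] by (intro DERIV_imp_deriv DERIV_diff d)
  show "max (deriv (plateau x h y h) r) 0 = deriv step ((r - x) / h) / h"
  proof (cases "r < x + h")
    case True
    then have "deriv step ((r - y) / h) = 0"
      using assms by (intro deriv_step_eq_0) (simp add: zero_less_divide_iff)
    then show ?thesis using assms by (simp add: deriv deriv_step_nonneg)
  next
    case False
    then have "deriv step ((r - x) / h) = 0"
      using assms by (intro deriv_step_eq_0) (simp add: divide_less_eq)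
    then show ?thesis using assms by (simp add: deriv deriv_step_nonneg)
  qed
qed

text \<open>The rising ramp contributes unit mass on [x, x + h], an approximation of the Dirac mass
  at x.\<close>

lemma has_bochner_integral_deriv_step:
  assumes "0 < h"
  shows "has_bochner_integral lborel (\<lambda>r. deriv step ((r - x) / h) / h) 1"
proof -
  have "has_bochner_integral lborel (\<lambda>r. deriv step ((r - x) / h) / h)
      (step ((x + h - x) / h) - step ((x - x) / h))"
  proof (rule has_bochner_integral_derivative[where F="\<lambda>r. step ((r - x) / h)"])
    show "((\<lambda>r. step ((r - x) / h)) has_real_derivative deriv step ((r - x) / h) / h) (at r)" for r
      by (rule DERIV_cong[OF DERIV_chain2[where g="\<lambda>r. (r - x) / h", OF smooth_DERIV[OF smooth_step]]])
        (use assms in \<open>auto intro!: derivative_eq_intros\<close>)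
    show "continuous_on UNIV (\<lambda>r. deriv step ((r - x) / h) / h)"
      using assms
      by (intro continuous_intros continuous_on_compose2[OF smooth_continuous_on[OF smooth_deriv[OF smooth_step]]])
        auto
    show "{r. deriv step ((r - x) / h) / h \<noteq> 0} \<subseteq> {x..x + h}"
    proof clarsimp
      fix r assume "deriv step ((r - x) / h) \<noteq> 0"
      then have "(r - x) / h \<in> {0<..<1}" using deriv_step_eq_0 by blast
      then show "x \<le> r \<and> r \<le> x + h" using assms by (auto simp: zero_less_divide_iff divide_less_eq)
    qed
  qed (use assms in auto)
  then show ?thesis using assms by (simp add: step_eq_0 step_eq_1)
qed

context
  fixes M1 M2 R1 R2 x h y N :: real
  assumes M: "0 < M1" "M1 < M2" "2 * M1 < x" and R: "0 \<le> R1" "R1 < x" "y + h < R2"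
    and h: "0 < h" "x + h < y"
  defines "N \<equiv> (LINT r|lborel. r\<^sup>2 * plateau x h y h r)"
begin

lemma integrable_square_plateau: "integrable lborel (\<lambda>r. r\<^sup>2 * plateau x h y h r)"
proof (rule integrable_continuous_compact_support)
  show "continuous_on UNIV (\<lambda>r. r\<^sup>2 * plateau x h y h r)"
    by (intro continuous_intros smooth_continuous_on smooth_plateau)
  show "{r. r\<^sup>2 * plateau x h y h r \<noteq> 0} \<subseteq> {x..y + h}"
    using plateau_support_Icc[of h x y] h by auto
qed

text \<open>The plateau lies between the indicators of [x + h, y] and [x, y + h], whose weighted
  integrals are differences of cubes.\<close>

lemma
  shows mass_plateau_ge: "(y ^ 3 - (x + h) ^ 3) / 3 \<le> N" and mass_plateau_le: "N \<le> A_fn R2 x"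
    and mass_plateau_pos: "0 < N"
proof -
  have "(LINT r|lborel. r\<^sup>2 * indicator {x + h..y} r) \<le> N"
    unfolding N_def using h
    by (intro integral_mono mult_left_mono indicator_le_plateau integrable_square_plateau
        integrable_square_Icc) auto
  then show ge: "(y ^ 3 - (x + h) ^ 3) / 3 \<le> N"
    using integral_square_Icc[of "x + h" y] h by simp
  have "N \<le> (LINT r|lborel. r\<^sup>2 * indicator {x..y + h} r)"
    unfolding N_def using h
    by (intro integral_mono mult_left_mono plateau_le_indicator integrable_square_plateau
        integrable_square_Icc) auto
  also have "\<dots> = ((y + h) ^ 3 - x ^ 3) / 3"
    using integral_square_Icc[of x "y + h"] h by simp
  also have "\<dots> \<le> A_fn R2 x"
    using R h by (simp add: A_fn_def power_mono)
  finally show "N \<le> A_fn R2 x" .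
  have "(x + h) ^ 3 < y ^ 3" using R h by (intro power_strict_mono) auto
  then show "0 < N" using ge by simp
qed

lemma plateau_in_A_smooth: "(\<lambda>r. inverse N * plateau x h y h r) \<in> A_smooth R1 R2"
  unfolding A_smooth_def
proof (intro CollectI conjI allI)
  show "smooth (\<lambda>r. inverse N * plateau x h y h r)" by (intro smooth_cmult smooth_plateau)
  show "0 \<le> inverse N * plateau x h y h r" for r
    using mass_plateau_pos plateau_nonneg[of h x y] h by simp
  have s: "{r. inverse N * plateau x h y h r \<noteq> 0} \<subseteq> {x..y + h}"
    using plateau_support_Icc[of h x y] h by auto
  have "{x..y + h} \<subseteq> {R1<..<R2}" using R by auto
  then show "supp (\<lambda>r. inverse N * plateau x h y h r) \<subseteq> {R1<..<R2}"
    using supp_subset_Icc[OF s] by blast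
  have "(LINT r:{R1..R2}|lborel. r\<^sup>2 * (inverse N * plateau x h y h r))
      = (LINT r|lborel. inverse N * (r\<^sup>2 * plateau x h y h r))"
    unfolding set_lebesgue_integral_def using s R
    by (intro Bochner_Integration.integral_cong) (force simp: indicator_def)+
  also have "\<dots> = inverse N * N" by (simp add: N_def)
  finally show "(LINT r:{R1..R2}|lborel. r\<^sup>2 * (inverse N * plateau x h y h r)) = 1"
    using mass_plateau_pos by simp
qed

text \<open>Up to the end of the rising ramp only [x, x + h] contributes, with integrand at most
  R2^2 / N. Hence the mass function is still M1 + O(h) there.\<close>

lemma P_fn_plateau_le:
  assumes "r \<le> x + h"
  shows "P_fn R1 (\<lambda>r. inverse N * plateau x h y h r) r \<le> inverse N * R2\<^sup>2 * h"
proof -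
  let ?u = "\<lambda>r. inverse N * plateau x h y h r"
  have n: "0 \<le> ?u r" for r using mass_plateau_pos plateau_nonneg[of h x y] h by simp
  have i: "integrable lborel (\<lambda>r. r\<^sup>2 * ?u r)"
    using integrable_mult_right[OF integrable_square_plateau, of "inverse N"] by (simp add: mult_ac)
  have "P_fn R1 ?u r \<le> (LINT s|lborel. (inverse N * R2\<^sup>2) * indicator {x..x + h} s)"
    unfolding P_fn_eq[OF n i]
  proof (rule integral_mono[OF integrable_P_fn[OF n i]])
    fix s
    show "s\<^sup>2 * ?u s * indicator {R1..r} s \<le> (inverse N * R2\<^sup>2) * indicator {x..x + h} s"
    proof (cases "s \<in> {x..x + h}")
      case True
      have "s\<^sup>2 \<le> R2\<^sup>2" using True R h by (intro power_mono) auto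
      moreover have "plateau x h y h s \<le> 1" using abs_plateau_le_1 abs_le_D1 by blast
      ultimately have "inverse N * (s\<^sup>2 * plateau x h y h s) \<le> inverse N * (R2\<^sup>2 * 1)"
        using mass_plateau_pos plateau_nonneg[of h x y s] h by (intro mult_left_mono mult_mono) auto
      then show ?thesis using True mass_plateau_pos by (auto simp: indicator_def mult_ac)
    next
      case False
      then have "plateau x h y h s = 0 \<or> s \<notin> {R1..r}"
        using plateau_support_Icc[of h x y] assms h by (cases "s < x") auto
      then show ?thesis using mass_plateau_pos by (auto simp: indicator_def)
    qed
  qed (intro integrable_mult_right integrable_real_indicator; simp add: emeasure_lborel_Icc_eq)
  also have "\<dots> = inverse N * R2\<^sup>2 * h" using h by simp
  finally show ?thesis .
qed

text \<open>The positive derivative has total mass 1/N and lives on (x, x + h). On that interval the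
  mass function lies between \<open>M1\<close> and M1 + O(h), so the weight r^3 / sqrt F lies
  between two constants. The hypothesis keeps the lower bound for F positive, so that its root may
  be inverted.\<close>

lemma J_plateau_bounds:
  assumes F: "0 < 1 - 2 * (M1 + (M2 - M1) * (inverse N * R2\<^sup>2 * h)) / x"
  shows "inverse N * (x ^ 3 / sqrt (1 - 2 * M1 / (x + h)))
      \<le> J M1 M2 R1 R2 (\<lambda>r. inverse N * plateau x h y h r)" (is ?lower)
    and "J M1 M2 R1 R2 (\<lambda>r. inverse N * plateau x h y h r)
      \<le> inverse N * ((x + h) ^ 3 / sqrt (1 - 2 * (M1 + (M2 - M1) * (inverse N * R2\<^sup>2 * h)) / x))"
      (is ?upper)
proof -
  let ?u = "\<lambda>r. inverse N * plateau x h y h r"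
  let ?F = "F_fn M1 M2 R1 ?u"
  define g where "g r = inverse N * (deriv step ((r - x) / h) / h)" for r
  define L where "L = x ^ 3 / sqrt (1 - 2 * M1 / (x + h))"
  define U where "U = (x + h) ^ 3 / sqrt (1 - 2 * (M1 + (M2 - M1) * (inverse N * R2\<^sup>2 * h)) / x)"
  have n: "0 \<le> ?u r" for r using mass_plateau_pos plateau_nonneg[of h x y] h by simp
  have i: "integrable lborel (\<lambda>r. r\<^sup>2 * ?u r)"
    using integrable_mult_right[OF integrable_square_plateau, of "inverse N"] by (simp add: mult_ac)
  note [measurable] = F_fn_measurable[OF n i]
  have g: "has_bochner_integral lborel g (inverse N)"
    using has_bochner_integral_mult_right[OF has_bochner_integral_deriv_step[OF h(1), of x], of "inverse N"]
    by (simp add: g_def[abs_def])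
  have gpos: "0 \<le> g r" for r
    using mass_plateau_pos h deriv_step_nonneg by (simp add: g_def)
  have "max (deriv ?u r) 0 = g r" for r
  proof -
    have "deriv ?u r = inverse N * deriv (plateau x h y h) r"
      by (intro DERIV_imp_deriv DERIV_cmult smooth_DERIV smooth_plateau)
    then have "max (deriv ?u r) 0 = inverse N * max (deriv (plateau x h y h) r) 0"
      using mass_plateau_pos by (simp add: max_def mult_le_0_iff zero_le_mult_iff)
    then show ?thesis
      using deriv_plateau_pos_part[of h x y r] h by (simp add: g_def)
  qed
  moreover have "{r. ?u r \<noteq> 0} \<subseteq> {R1..R2}"
    using plateau_support_Icc[of h x y] h R by force
  ultimately have J: "J M1 M2 R1 R2 ?u = (LINT r|lborel. g r * (r ^ 3 / sqrt (?F r)))"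
    using J_smooth[of ?u R1 R2 M1 M2] by (simp add: smooth_cmult smooth_plateau F_fn_measurable[OF n i])
  have bounds: "g r * L \<le> g r * (r ^ 3 / sqrt (?F r)) \<and> g r * (r ^ 3 / sqrt (?F r)) \<le> g r * U" for r
  proof (cases "g r = 0")
    case False
    have "L \<le> r ^ 3 / sqrt (?F r) \<and> r ^ 3 / sqrt (?F r) \<le> U"
    proof -
      have "(r - x) / h \<in> {0<..<1}" using False deriv_step_eq_0 unfolding g_def by fastforce
      then have r: "x < r" "r < x + h" using h by (auto simp: zero_less_divide_iff divide_less_eq)
      let ?m = "m_fn M1 M2 R1 ?u r"
      let ?mu = "M1 + (M2 - M1) * (inverse N * R2\<^sup>2 * h)"
      have m: "M1 \<le> ?m" "?m \<le> ?mu"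
        using P_fn_nonneg[OF n i, of R1 r] P_fn_plateau_le[of r] r M
        by (auto simp: m_fn_def intro: mult_left_mono)
      have "?m / r \<le> ?mu / x" "M1 / (x + h) \<le> ?m / r"
        using m r M by (intro frac_le; linarith)+
      then have F: "1 - 2 * ?mu / x \<le> ?F r" "?F r \<le> 1 - 2 * M1 / (x + h)"
        unfolding F_fn_def times_divide_eq_right[symmetric] by linarith+
      have "0 < ?F r" using F(1) assms by linarith
      then have "sqrt (1 - 2 * ?mu / x) \<le> sqrt (?F r)" "sqrt (?F r) \<le> sqrt (1 - 2 * M1 / (x + h))"
        "0 < sqrt (1 - 2 * ?mu / x)" "0 < sqrt (?F r)"
        using F assms by (simp_all only: real_sqrt_le_iff real_sqrt_gt_0_iff)
      moreover have "x ^ 3 \<le> r ^ 3" "r ^ 3 \<le> (x + h) ^ 3" "0 \<le> r ^ 3" "0 \<le> (x + h) ^ 3"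
        using r M by (auto intro: power_mono)
      ultimately show ?thesis
        unfolding L_def U_def by (intro conjI frac_le)
    qed
    then show ?thesis
      using gpos[of r] by (blast intro: mult_left_mono)
  qed simp
  have L: "0 \<le> L"
    using M h by (simp add: L_def)
  have [measurable]: "g \<in> borel_measurable borel"
    using borel_measurable_has_bochner_integral[OF g] by simp
  have int: "integrable lborel (\<lambda>r. g r * L)" "integrable lborel (\<lambda>r. g r * U)"
    using g by (auto simp: has_bochner_integral_iff)
  \<comment> \<open>The integrand is squeezed between the nonnegative \<open>g r * L\<close> and the
    integrable \<open>g r * U\<close>, hence dominated in absolute value.\<close>
  have intF: "integrable lborel (\<lambda>r. g r * (r ^ 3 / sqrt (?F r)))"
  proof (rule Bochner_Integration.integrable_bound[OF int(2)])
    have "\<bar>g r * (r ^ 3 / sqrt (?F r))\<bar> \<le> \<bar>g r * U\<bar>" for r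
      using bounds[of r] mult_nonneg_nonneg[OF gpos[of r] L] by linarith
    then show "AE r in lborel. norm (g r * (r ^ 3 / sqrt (?F r))) \<le> norm (g r * U)"
      by simp
  qed measurable
  show ?lower
    using integral_mono[OF int(1) intF conjunct1[OF bounds]] g
    by (simp add: J has_bochner_integral_iff L_def)
  show ?upper
    using integral_mono[OF intF int(2) conjunct2[OF bounds]] g
    by (simp add: J has_bochner_integral_iff U_def)
qed

end

section \<open>Smooth competitors with energy close to \<open>Psi\<close>\<close>

text \<open>In this form \<open>Psi\<close> is visibly a jump energy: 1/A is the height of the
  unit-mass profile on (x, R2), and the other factor is the energy weight at x with enclosed mass
  still \<open>M1\<close>.\<close>

lemma Psi_eq:
  assumes "0 < M1" "2 * M1 < x"
  shows "Psi M1 R2 x = inverse (A_fn R2 x) * (x ^ 3 / sqrt (1 - 2 * M1 / x))"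
proof -
  have "x powr (7/2) = x powr 3 * x powr (1/2)"
    using assms by (subst powr_add[symmetric]) simp
  then have "x powr (7/2) = x ^ 3 * sqrt x"
    using assms by (simp add: powr_half_sqrt)
  moreover have "sqrt (x - 2 * M1) = sqrt x * sqrt (1 - 2 * M1 / x)"
    using assms by (simp add: real_sqrt_mult[symmetric] algebra_simps)
  ultimately show ?thesis
    using assms by (simp add: Psi_def q_fn_def divide_simps)
qed

text \<open>The normalisation N depends on h only through an integral, so it is replaced by explicit
  bounds: N <= A(x) gives the lower bound \<open>lo\<close>, and 1/N <= \<open>cb h\<close> gives
  the upper bound \<open>up\<close>. Both tend to \<open>Psi\<close> at x as h decreases to
  0.\<close>

lemma near_optimal_smooth:
  assumes M: "0 < M1" "M1 < M2" "2 * M1 < x" and R: "0 \<le> R1" "R1 < x" "x < R2" and d: "0 < d"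
  obtains u where "u \<in> A_smooth R1 R2" "\<And>r. r \<le> x \<Longrightarrow> u r = 0"
    "\<bar>J M1 M2 R1 R2 u - Psi M1 R2 x\<bar> < d"
proof -
  \<comment> \<open>The reciprocal of the lower mass bound for a plateau whose descent starts at R2
    - 2h.\<close>
  define cb where "cb h = inverse (((R2 - 2 * h) ^ 3 - (x + h) ^ 3) / 3)" for h
  define lo where "lo h = inverse (A_fn R2 x) * (x ^ 3 / sqrt (1 - 2 * M1 / (x + h)))" for h
  define up where "up h = cb h * ((x + h) ^ 3 / sqrt (1 - 2 * (M1 + (M2 - M1) * (cb h * R2\<^sup>2 * h)) / x))" for h
  have A: "0 < R2 ^ 3 - x ^ 3" using M R by (simp add: power_strict_mono)
  have x: "0 < 1 - 2 * M1 / x" using M by simp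
  have cb: "(cb \<longlongrightarrow> inverse (((R2 - 2 * 0) ^ 3 - (x + 0) ^ 3) / 3)) (at_right 0)"
    unfolding cb_def using A by (intro tendsto_intros) auto
  then have "((\<lambda>h. 1 - 2 * (M1 + (M2 - M1) * (cb h * R2\<^sup>2 * h)) / x) \<longlongrightarrow>
      1 - 2 * (M1 + (M2 - M1) * (inverse (((R2 - 2 * 0) ^ 3 - (x + 0) ^ 3) / 3) * R2\<^sup>2 * 0)) / x) (at_right 0)"
    using M by (intro tendsto_intros) auto
  then have F: "((\<lambda>h. 1 - 2 * (M1 + (M2 - M1) * (cb h * R2\<^sup>2 * h)) / x) \<longlongrightarrow> 1 - 2 * M1 / x) (at_right 0)"
    by simp
  have "(up \<longlongrightarrow> inverse (((R2 - 2 * 0) ^ 3 - (x + 0) ^ 3) / 3) * ((x + 0) ^ 3 / sqrt (1 - 2 * M1 / x))) (at_right 0)"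
    unfolding up_def using x by (intro tendsto_intros F cb) auto
  then have up: "(up \<longlongrightarrow> Psi M1 R2 x) (at_right 0)"
    using M by (simp add: Psi_eq A_fn_def)
  have "(lo \<longlongrightarrow> inverse (A_fn R2 x) * (x ^ 3 / sqrt (1 - 2 * M1 / (x + 0)))) (at_right 0)"
    unfolding lo_def using x M by (intro tendsto_intros) auto
  then have lo: "(lo \<longlongrightarrow> Psi M1 R2 x) (at_right 0)"
    using M by (simp add: Psi_eq)
  \<comment> \<open>Taking h below (R2 - x)/8 ensures x + h < R2 - 2h, so the ramps stay
    apart.\<close>
  have ev: "\<forall>\<^sub>F h in at_right 0. h \<in> {0<..<(R2 - x) / 8} \<and> 0 < 1 - 2 * (M1 + (M2 - M1) * (cb h * R2\<^sup>2 * h)) / x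
      \<and> up h < Psi M1 R2 x + d \<and> Psi M1 R2 x - d < lo h"
    using R d by (intro eventually_conj eventually_at_right_real order_tendstoD(1)[OF F] x
        order_tendstoD(2)[OF up] order_tendstoD(1)[OF lo]) auto
  obtain h where h: "0 < h" "h < (R2 - x) / 8"
      and Fh: "0 < 1 - 2 * (M1 + (M2 - M1) * (cb h * R2\<^sup>2 * h)) / x"
      and b: "up h < Psi M1 R2 x + d" "Psi M1 R2 x - d < lo h"
    using eventually_happens'[OF trivial_limit_at_right_real ev] by (auto simp del: divide_less_eq_1_pos)
  \<comment> \<open>The descent then ends at R2 - h, which keeps the support strictly inside (R1,
    R2).\<close>
  define y where "y = R2 - 2 * h"
  have y: "y + h < R2" "x + h < y" using h by (auto simp: y_def)
  define N where "N = (LINT r|lborel. r\<^sup>2 * plateau x h y h r)"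
  define u where "u = (\<lambda>r. inverse N * plateau x h y h r)"
  note * = M R(1,2) y(1) h(1) y(2)
  have N: "0 < N" "N \<le> A_fn R2 x" "((R2 - 2 * h) ^ 3 - (x + h) ^ 3) / 3 \<le> N"
    unfolding N_def using mass_plateau_pos[OF *] mass_plateau_le[OF *] mass_plateau_ge[OF *] by (auto simp: y_def)
  have "(x + h) ^ 3 < (R2 - 2 * h) ^ 3" using M R y h by (intro power_strict_mono) (auto simp: y_def)
  then have "inverse N \<le> cb h"
    unfolding cb_def by (intro le_imp_inverse_le[OF N(3)]) simp
  with N(1) have cbh: "inverse N \<le> cb h" "0 < inverse N" "0 \<le> cb h"
    by (auto intro: order_trans[of 0 "inverse N"])
  have Fle: "1 - 2 * (M1 + (M2 - M1) * (cb h * R2\<^sup>2 * h)) / x \<le> 1 - 2 * (M1 + (M2 - M1) * (inverse N * R2\<^sup>2 * h)) / x"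
    using M h cbh by (intro diff_left_mono divide_right_mono mult_left_mono add_left_mono mult_right_mono) auto
  have FN: "0 < 1 - 2 * (M1 + (M2 - M1) * (inverse N * R2\<^sup>2 * h)) / x"
    using Fh Fle by linarith
  have J: "inverse N * (x ^ 3 / sqrt (1 - 2 * M1 / (x + h))) \<le> J M1 M2 R1 R2 u"
    "J M1 M2 R1 R2 u \<le> inverse N * ((x + h) ^ 3 / sqrt (1 - 2 * (M1 + (M2 - M1) * (inverse N * R2\<^sup>2 * h)) / x))"
    unfolding u_def using J_plateau_bounds[OF *, folded N_def, OF FN] by blast+
  have "0 \<le> x ^ 3 / sqrt (1 - 2 * M1 / (x + h))" using M h by simp
  then have "lo h \<le> inverse N * (x ^ 3 / sqrt (1 - 2 * M1 / (x + h)))"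
    unfolding lo_def using N by (intro mult_right_mono le_imp_inverse_le) auto
  moreover have "inverse N * ((x + h) ^ 3 / sqrt (1 - 2 * (M1 + (M2 - M1) * (inverse N * R2\<^sup>2 * h)) / x)) \<le> up h"
  proof -
    have "(x + h) ^ 3 / sqrt (1 - 2 * (M1 + (M2 - M1) * (inverse N * R2\<^sup>2 * h)) / x)
        \<le> (x + h) ^ 3 / sqrt (1 - 2 * (M1 + (M2 - M1) * (cb h * R2\<^sup>2 * h)) / x)" (is "_ \<le> ?z")
      using M h real_sqrt_le_mono[OF Fle] Fh by (intro frac_le real_sqrt_gt_zero) auto
    moreover have "0 \<le> (x + h) ^ 3 / sqrt (1 - 2 * (M1 + (M2 - M1) * (inverse N * R2\<^sup>2 * h)) / x)"
      using M h real_sqrt_ge_zero[OF less_imp_le[OF FN]] by (intro divide_nonneg_nonneg zero_le_power) auto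
    ultimately show ?thesis
      unfolding up_def using cbh by (intro mult_mono) auto
  qed
  ultimately have "\<bar>J M1 M2 R1 R2 u - Psi M1 R2 x\<bar> < d"
    using J b by linarith
  moreover have "u \<in> A_smooth R1 R2"
    unfolding u_def N_def by (rule plateau_in_A_smooth[OF *])
  moreover have "u r = 0" if "r \<le> x" for r
    using that h y by (simp add: u_def plateau_def step_eq_0 divide_nonpos_pos)
  ultimately show thesis using that by blast
qed

section \<open>Lower bounds for the profile and metric errors\<close>

text \<open>In the measurable case the set where the function exceeds its essential supremum is
  null, so it cannot contain S. For a non-measurable function \<open>esssup\<close> is infinite and
  the bound is immediate.\<close>

lemma Linf_norm_ge:
  assumes S: "S \<in> sets borel" "S \<subseteq> {R1..R2}" "emeasure lborel S \<noteq> 0"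
    and k: "\<And>r. r \<in> S \<Longrightarrow> k \<le> \<bar>f r\<bar>"
  shows "ereal k \<le> Linf_norm R1 R2 f"
proof (cases "(\<lambda>r. ereal \<bar>f r\<bar>) \<in> borel_measurable (restrict_space lborel {R1..R2})")
  case [measurable]: True
  let ?M = "restrict_space lborel {R1..R2}" and ?f = "\<lambda>r. ereal \<bar>f r\<bar>"
  have sp: "space ?M = {R1..R2}" by (simp add: space_restrict_space)
  show ?thesis
  proof (rule ccontr)
    assume "\<not> ereal k \<le> Linf_norm R1 R2 f"
    then have less: "esssup ?M ?f < ereal k" by (simp add: Linf_norm_def)
    have "S \<subseteq> {r \<in> space ?M. ?f r > esssup ?M ?f}"
    proof
      fix r assume "r \<in> S"
      then have "r \<in> space ?M" "ereal k \<le> ?f r" using S(2) k by (auto simp: sp)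
      then show "r \<in> {r \<in> space ?M. ?f r > esssup ?M ?f}" using less by (auto intro: less_le_trans)
    qed
    then have "emeasure ?M S \<le> emeasure ?M {r \<in> space ?M. ?f r > esssup ?M ?f}"
      by (rule emeasure_mono) measurable
    then have "emeasure ?M S = 0"
      unfolding esssup_zero_measure by simp
    then show False
      using S by (simp add: emeasure_restrict_space)
  qed
qed (simp add: Linf_norm_def esssup_non_measurable)

lemma Linf_norm_nonneg:
  assumes "R1 < R2"
  shows "0 \<le> Linf_norm R1 R2 f"
  using Linf_norm_ge[of "{R1..R2}" R1 R2 0 f] assms by (simp add: zero_ereal_def)

text \<open>On (a, a + e) the minimizer has height \<open>H_opt\<close> while \<open>u\<close>
  vanishes.\<close>

lemma profile_error_ge:
  assumes u: "integrable lborel u" "\<And>r. r \<le> a_opt M1 R1 R2 + e \<Longrightarrow> u r = 0"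
    and e: "0 \<le> e" "a_opt M1 R1 R2 + e < R2" and H: "0 \<le> H_opt M1 R1 R2"
  shows "H_opt M1 R1 R2 * e \<le> profile_error M1 R1 R2 u"
proof -
  let ?a = "a_opt M1 R1 R2" and ?H = "H_opt M1 R1 R2"
  have "integrable lborel (\<lambda>r. ?H * indicator {?a<..<R2} r)"
    by (intro integrable_mult_right integrable_real_indicator) (use e in auto)
  then have i: "integrable lborel (\<lambda>r. \<bar>u r - u_opt M1 R1 R2 r\<bar>)"
    unfolding u_opt_def[abs_def] using u(1) by (intro integrable_abs Bochner_Integration.integrable_diff)
  have "?H * e = (LINT r|lborel. ?H * indicator {?a<..<?a + e} r)"
    using e by simp
  also have "\<dots> \<le> profile_error M1 R1 R2 u"
    unfolding profile_error_def
  proof (rule integral_mono[OF _ i])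
    show "integrable lborel (\<lambda>r. ?H * indicator {?a<..<?a + e} r)"
      by (intro integrable_mult_right integrable_real_indicator) (use e in auto)
    show "?H * indicator {?a<..<?a + e} r \<le> \<bar>u r - u_opt M1 R1 R2 r\<bar>" for r
      using u(2)[of r] e H by (auto simp: u_opt_def indicator_def)
  qed
  finally show ?thesis .
qed

text \<open>The enclosed-mass term alone suffices, the other three norms being nonnegative. On
  [a + e/2, a + e] the mass of \<open>u\<close> is still 0, while that of the minimizer is at least
  H R1^2 (r - a). A whole interval is used because the norm ignores null sets.\<close>

lemma metric_error_ge:
  assumes u: "\<And>r. r \<le> a_opt M1 R1 R2 + e \<Longrightarrow> u r = 0"
    and e: "0 < e" "a_opt M1 R1 R2 + e < R2" and H: "0 \<le> H_opt M1 R1 R2" and R: "0 \<le> R1" "R1 < R2"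
  shows "ereal (H_opt M1 R1 R2 * R1\<^sup>2 * e / 2) \<le> metric_error M1 M2 R1 R2 u"
proof -
  let ?a = "a_opt M1 R1 R2" and ?H = "H_opt M1 R1 R2"
  have a: "R1 \<le> ?a" by (simp add: a_opt_def)
  have "ereal (?H * R1\<^sup>2 * e / 2) \<le> Linf_norm R1 R2 (\<lambda>r. P_fn R1 u r - P_fn R1 (u_opt M1 R1 R2) r)"
  proof (rule Linf_norm_ge[where S="{?a + e / 2..?a + e}"])
    fix r assume r: "r \<in> {?a + e / 2..?a + e}"
    have "P_fn R1 u r = (LINT s|lborel. 0 * indicator {R1..r} s)"
      unfolding P_fn_def set_lebesgue_integral_def using u r
      by (intro Bochner_Integration.integral_cong) (auto simp: indicator_def)
    then have P: "P_fn R1 u r = 0" by simp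
    have "?H * R1\<^sup>2 * (e / 2) \<le> ?H * R1\<^sup>2 * (r - ?a)"
      using H r by (intro mult_left_mono) auto
    also have "\<dots> = (LINT s|lborel. ?H * R1\<^sup>2 * indicator {?a<..<r} s)"
      using r e by simp
    also have "\<dots> \<le> P_fn R1 (u_opt M1 R1 R2) r"
      unfolding P_fn_def set_lebesgue_integral_def
    proof (rule integral_mono)
      show "integrable lborel (\<lambda>s. ?H * R1\<^sup>2 * indicator {?a<..<r} s)"
        by (intro integrable_mult_right integrable_real_indicator) (use e r in auto)
      have "R1 \<le> r" using e r a by auto
      then have "integrable lborel (\<lambda>s. ?H * (s\<^sup>2 * indicator {R1..r} s))"
        by (intro integrable_mult_right integrable_square_Icc)
      then have "integrable lborel (\<lambda>s. (?H * (s\<^sup>2 * indicator {R1..r} s)) * indicator {?a<..<R2} s)"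
        by (intro integrable_real_mult_indicator) auto
      also have "(\<lambda>s. (?H * (s\<^sup>2 * indicator {R1..r} s)) * indicator {?a<..<R2} s)
          = (\<lambda>s. indicator {R1..r} s *\<^sub>R (s\<^sup>2 * u_opt M1 R1 R2 s))"
        by (auto simp: u_opt_def fun_eq_iff)
      finally show "integrable lborel (\<lambda>s. indicator {R1..r} s *\<^sub>R (s\<^sup>2 * u_opt M1 R1 R2 s))" .
      fix s
      show "?H * R1\<^sup>2 * indicator {?a<..<r} s \<le> indicator {R1..r} s *\<^sub>R (s\<^sup>2 * u_opt M1 R1 R2 s)"
      proof (cases "s \<in> {?a<..<r}")
        case True
        then have "?H * R1\<^sup>2 \<le> ?H * s\<^sup>2"
          using H R a by (intro mult_left_mono power_mono) auto
        then show ?thesis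
          using True a e r by (simp add: u_opt_def mult_ac)
      qed (use H in \<open>auto simp: u_opt_def indicator_def\<close>)
    qed
    finally show "?H * R1\<^sup>2 * e / 2 \<le> \<bar>P_fn R1 u r - P_fn R1 (u_opt M1 R1 R2) r\<bar>"
      using P by simp
  qed (use a e in auto)
  then show ?thesis
    unfolding metric_error_def Let_def by (intro add_increasing2 Linf_norm_nonneg R)
qed

section \<open>Optimality of the exponents\<close>

text \<open>An error of order e and a deficit O(e^p) would give \<kappa> <= |C| K^\<gamma>
  e^(p\<gamma> - 1), whose right-hand side tends to 0 because p\<gamma> > 1.\<close>

lemma not_bounded_by_higher_power:
  fixes \<kappa> C K p \<gamma> :: real
  assumes "0 < \<kappa>" "1 < p * \<gamma>" "0 < \<gamma>" "0 \<le> K"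
    and ev: "\<forall>\<^sub>F e in at_right 0. \<exists>\<delta>. 0 \<le> \<delta> \<and> \<delta> \<le> K * e powr p \<and> \<kappa> * e \<le> C * \<delta> powr \<gamma>"
  shows False
proof -
  have "((\<lambda>e. \<bar>C\<bar> * K powr \<gamma> * e powr (p * \<gamma> - 1)) \<longlongrightarrow> \<bar>C\<bar> * K powr \<gamma> * 0) (at_right 0)"
    using assms(2) by (intro tendsto_mult_left tendsto_zero_powrI[where b="p * \<gamma> - 1"] tendsto_intros)
      (auto simp: eventually_at_filter)
  then have "\<forall>\<^sub>F e in at_right 0. \<bar>C\<bar> * K powr \<gamma> * e powr (p * \<gamma> - 1) < \<kappa>"
    using assms(1) by (intro order_tendstoD(2)[where a=\<kappa>]) auto
  then have "\<forall>\<^sub>F e in at_right (0::real). False"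
    using ev eventually_at_right_less[of 0]
  proof eventually_elim
    case (elim e)
    then obtain \<delta> where \<delta>: "0 \<le> \<delta>" "\<delta> \<le> K * e powr p" "\<kappa> * e \<le> C * \<delta> powr \<gamma>" by blast
    \<comment> \<open>The sign of C is arbitrary, so its absolute value is taken before using
      monotonicity of the power.\<close>
    have "C * \<delta> powr \<gamma> \<le> \<bar>C\<bar> * (K * e powr p) powr \<gamma>"
      using \<delta> assms by (intro mult_mono powr_mono2) auto
    also have "\<dots> = \<bar>C\<bar> * K powr \<gamma> * e powr (p * \<gamma> - 1) * e"
      using assms elim by (simp add: powr_mult powr_powr powr_diff)
    also have "\<dots> < \<kappa> * e"
      using elim by (intro mult_strict_right_mono) auto
    finally show False using \<delta>(3) by simp
  qed
  then show False by simp
qed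

lemma
  assumes "\<A> \<subseteq> \<B>"
  shows profile_estimate_subset:
      "profile_estimate M1 M2 R1 R2 \<B> \<gamma> \<Longrightarrow> profile_estimate M1 M2 R1 R2 \<A> \<gamma>"
    and metric_estimate_subset:
      "metric_estimate M1 M2 R1 R2 \<B> \<gamma> \<Longrightarrow> metric_estimate M1 M2 R1 R2 \<A> \<gamma>"
  using assms unfolding profile_estimate_def metric_estimate_def by blast+

context
  fixes M1 M2 R1 R2 :: real
  assumes M: "0 < M1" "M1 < M2" "2 * M2 < R1" and R: "R1 < R2"
begin

lemma
  shows a_opt_less: "a_opt M1 R1 R2 < R2" and H_opt_pos: "0 < H_opt M1 R1 R2"
    and critical_cubic_a_opt: "0 \<le> critical_cubic M1 R2 (a_opt M1 R1 R2)"
proof -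
  note c = critical_cubic_x0[of M1 R2] x0_less[of M1 R2]
  show a: "a_opt M1 R1 R2 < R2" using c M R by (simp add: a_opt_def)
  then have "a_opt M1 R1 R2 ^ 3 < R2 ^ 3"
    using M by (intro power_strict_mono) (auto simp: a_opt_def)
  then show "0 < H_opt M1 R1 R2" by (simp add: H_opt_def A_fn_def)
  show "0 \<le> critical_cubic M1 R2 (a_opt M1 R1 R2)"
    using c M R critical_cubic_less[of M1 R2 "x0 M1 R2" R1] by (auto simp: a_opt_def max_def)
qed

text \<open>The exponent p records the regime: 1 for the general linear increment of
  \<open>Psi\<close>, 2 when the cubic vanishes at the optimal radius.\<close>

lemma small_deficit_family:
  assumes p: "p = 1 \<or> p = 2 \<and> critical_cubic M1 R2 (a_opt M1 R1 R2) = 0"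
  obtains K where "0 \<le> K" "\<forall>\<^sub>F e in at_right 0. a_opt M1 R1 R2 + e < R2 \<and>
    (\<exists>u\<in>A_smooth R1 R2. (\<forall>r\<le>a_opt M1 R1 R2 + e. u r = 0) \<and>
       0 \<le> deficit M1 M2 R1 R2 u \<and> deficit M1 M2 R1 R2 u \<le> 1 \<and>
       deficit M1 M2 R1 R2 u \<le> K * e powr p)"
proof -
  let ?a = "a_opt M1 R1 R2" and ?g = "critical_cubic M1 R2 (a_opt M1 R1 R2)"
  have a: "R1 \<le> ?a" by (simp add: a_opt_def)
  then have a': "2 * M1 < ?a" using M by linarith
  obtain K where K: "0 \<le> K" and incr: "\<forall>e>0. ?a + e \<le> (?a + R2) / 2 \<longrightarrow>
      Psi M1 R2 ?a < Psi M1 R2 (?a + e) \<and>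
      Psi M1 R2 (?a + e) - Psi M1 R2 ?a \<le> K * (?g * e + e\<^sup>2)"
    using Psi_increment[OF M(1) a' a_opt_less critical_cubic_a_opt] by blast
  \<comment> \<open>The 2 comes from the deficit being at most twice the increment. The factor g + 1
    absorbs g e + e^2: for p = 1 since e^2 <= e when e < 1, for p = 2 since g = 0.\<close>
  define K' where "K' = 2 * K * (?g + 1)"
  have K': "0 \<le> K'" using K critical_cubic_a_opt by (simp add: K'_def)
  have "((\<lambda>e. K' * e powr p) \<longlongrightarrow> K' * 0) (at_right 0)"
    using p by (intro tendsto_mult_left tendsto_zero_powrI[where b=p] tendsto_intros)
      (auto simp: eventually_at_filter)
  then have "\<forall>\<^sub>F e in at_right 0. K' * e powr p < 1"
    by (intro order_tendstoD(2)[where a=1]) auto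
  moreover have "\<forall>\<^sub>F e in at_right 0. e \<in> {0<..<min 1 ((R2 - ?a) / 2)}"
    using a_opt_less by (intro eventually_at_right_real) auto
  ultimately have "\<forall>\<^sub>F e in at_right 0. ?a + e < R2 \<and>
    (\<exists>u\<in>A_smooth R1 R2. (\<forall>r\<le>?a + e. u r = 0) \<and>
       0 \<le> deficit M1 M2 R1 R2 u \<and> deficit M1 M2 R1 R2 u \<le> 1 \<and>
       deficit M1 M2 R1 R2 u \<le> K' * e powr p)"
  proof eventually_elim
    case (elim e)
    then have e: "0 < e" "e < 1" "?a + e \<le> (?a + R2) / 2" "?a + e < R2" by (auto simp: field_simps)
    \<comment> \<open>The increment itself serves as the approximation tolerance, which confines the
      deficit between 0 and 2d.\<close>
    define d where "d = Psi M1 R2 (?a + e) - Psi M1 R2 ?a"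
    have d: "0 < d" "d \<le> K * (?g * e + e\<^sup>2)" using incr e(1,3) by (simp_all add: d_def)
    have x: "2 * M1 < ?a + e" "0 \<le> R1" "R1 < ?a + e" using M a a' e by linarith+
    obtain u where u: "u \<in> A_smooth R1 R2" "\<And>r. r \<le> ?a + e \<Longrightarrow> u r = 0"
      "\<bar>J M1 M2 R1 R2 u - Psi M1 R2 (?a + e)\<bar> < d"
      using near_optimal_smooth[OF M(1,2) x e(4) d(1)] by metis
    have "d \<le> K * (?g * e + e\<^sup>2)" by (rule d(2))
    also have "\<dots> \<le> K * ((?g + 1) * e powr p)"
    proof (intro mult_left_mono K)
      have "e\<^sup>2 \<le> e" using e by (simp add: power2_eq_square mult_le_cancel_left1)
      then show "?g * e + e\<^sup>2 \<le> (?g + 1) * e powr p"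
        using p e by (auto simp: algebra_simps powr_numeral)
    qed
    finally have d: "2 * d \<le> K' * e powr p" by (simp add: K'_def)
    have "deficit M1 M2 R1 R2 u = J M1 M2 R1 R2 u - Psi M1 R2 (?a + e) + d"
      by (simp add: deficit_def lambda_opt_def d_def)
    then have "0 \<le> deficit M1 M2 R1 R2 u" "deficit M1 M2 R1 R2 u \<le> 2 * d"
      using u(3) by linarith+
    moreover from this have "deficit M1 M2 R1 R2 u \<le> 1" "deficit M1 M2 R1 R2 u \<le> K' * e powr p"
      using d elim(1) by linarith+
    ultimately show ?case using u(1,2) e(4) by blast
  qed
  then show thesis by (rule that[OF K'])
qed

text \<open>The condition p\<gamma> > 1 treats both regimes at once: it reads \<gamma> > 1/2 for p =
  2 and \<gamma> > 1 for p = 1.\<close>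

lemma
  assumes p: "p = 1 \<or> p = 2 \<and> critical_cubic M1 R2 (a_opt M1 R1 R2) = 0" and \<gamma>: "1 < p * \<gamma>"
  shows not_profile_estimate_smooth: "\<not> profile_estimate M1 M2 R1 R2 (A_smooth R1 R2) \<gamma>"
    and not_metric_estimate_smooth: "\<not> metric_estimate M1 M2 R1 R2 (A_smooth R1 R2) \<gamma>"
proof -
  have \<gamma>pos: "0 < \<gamma>" using p \<gamma> by auto
  obtain K where K: "0 \<le> K" and ev: "\<forall>\<^sub>F e in at_right 0. a_opt M1 R1 R2 + e < R2 \<and>
    (\<exists>u\<in>A_smooth R1 R2. (\<forall>r\<le>a_opt M1 R1 R2 + e. u r = 0) \<and>
       0 \<le> deficit M1 M2 R1 R2 u \<and> deficit M1 M2 R1 R2 u \<le> 1 \<and>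
       deficit M1 M2 R1 R2 u \<le> K * e powr p)"
    using small_deficit_family[OF p] by blast
  note pos = eventually_at_right_less[of "0::real"]
  show "\<not> profile_estimate M1 M2 R1 R2 (A_smooth R1 R2) \<gamma>"
  proof
    assume "profile_estimate M1 M2 R1 R2 (A_smooth R1 R2) \<gamma>"
    then obtain C where C: "\<And>u. u \<in> A_smooth R1 R2 \<Longrightarrow> deficit M1 M2 R1 R2 u \<le> 1 \<Longrightarrow>
        profile_error M1 R1 R2 u \<le> C * deficit M1 M2 R1 R2 u powr \<gamma>"
      by (auto simp: profile_estimate_def)
    have "\<forall>\<^sub>F e in at_right 0. \<exists>\<delta>. 0 \<le> \<delta> \<and> \<delta> \<le> K * e powr p \<and>
        H_opt M1 R1 R2 * e \<le> C * \<delta> powr \<gamma>"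
      using ev pos
    proof eventually_elim
      case (elim e)
      from elim(1) obtain u where u: "u \<in> A_smooth R1 R2" "\<forall>r\<le>a_opt M1 R1 R2 + e. u r = 0"
        "0 \<le> deficit M1 M2 R1 R2 u" "deficit M1 M2 R1 R2 u \<le> 1" "deficit M1 M2 R1 R2 u \<le> K * e powr p"
        by blast
      have "integrable lborel u"
        using A_smooth_subset_A_BV u(1) by (auto simp: A_BV_def BV_def)
      then have "H_opt M1 R1 R2 * e \<le> profile_error M1 R1 R2 u"
        using profile_error_ge[of u M1 R1 R2 e] u(2) elim H_opt_pos by auto
      then have "H_opt M1 R1 R2 * e \<le> C * deficit M1 M2 R1 R2 u powr \<gamma>"
        using C[OF u(1,4)] by linarith
      then show ?case using u(3,5) by blast
    qed
    then show False
      by (rule not_bounded_by_higher_power[OF H_opt_pos \<gamma> \<gamma>pos K])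
  qed
  show "\<not> metric_estimate M1 M2 R1 R2 (A_smooth R1 R2) \<gamma>"
  proof
    assume "metric_estimate M1 M2 R1 R2 (A_smooth R1 R2) \<gamma>"
    then obtain C where C: "\<And>u. u \<in> A_smooth R1 R2 \<Longrightarrow> deficit M1 M2 R1 R2 u \<le> 1 \<Longrightarrow>
        metric_error M1 M2 R1 R2 u \<le> ereal (C * deficit M1 M2 R1 R2 u powr \<gamma>)"
      by (auto simp: metric_estimate_def)
    have "\<forall>\<^sub>F e in at_right 0. \<exists>\<delta>. 0 \<le> \<delta> \<and> \<delta> \<le> K * e powr p \<and>
        (H_opt M1 R1 R2 * R1\<^sup>2 / 2) * e \<le> C * \<delta> powr \<gamma>"
      using ev pos
    proof eventually_elim
      case (elim e)
      from elim(1) obtain u where u: "u \<in> A_smooth R1 R2" "\<forall>r\<le>a_opt M1 R1 R2 + e. u r = 0"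
        "0 \<le> deficit M1 M2 R1 R2 u" "deficit M1 M2 R1 R2 u \<le> 1" "deficit M1 M2 R1 R2 u \<le> K * e powr p"
        by blast
      have "ereal (H_opt M1 R1 R2 * R1\<^sup>2 * e / 2) \<le> metric_error M1 M2 R1 R2 u"
        using metric_error_ge[of M1 R1 R2 e u M2] u(2) elim H_opt_pos M R by auto
      also note C[OF u(1,4)]
      finally have "(H_opt M1 R1 R2 * R1\<^sup>2 / 2) * e \<le> C * deficit M1 M2 R1 R2 u powr \<gamma>"
        by simp
      then show ?case using u(3,5) by blast
    qed
    moreover have "0 < H_opt M1 R1 R2 * R1\<^sup>2 / 2" using H_opt_pos M R by simp
    ultimately show False
      by (intro not_bounded_by_higher_power[OF _ \<gamma> \<gamma>pos K])
  qed
qed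

end

theorem proposition4p5:
  fixes M1 M2 R1 R2 :: real
  assumes "0 < M1" and "M1 < M2" and "2 * M2 < R1" and "R1 < R2"
  shows "(a_opt M1 R1 R2 = x0 M1 R2 \<longrightarrow>
            (\<forall>\<gamma>>1/2.
               \<not> profile_estimate M1 M2 R1 R2 (A_BV R1 R2) \<gamma> \<and>
               \<not> profile_estimate M1 M2 R1 R2 (A_smooth R1 R2) \<gamma> \<and>
               \<not> metric_estimate M1 M2 R1 R2 (A_BV R1 R2) \<gamma> \<and>
               \<not> metric_estimate M1 M2 R1 R2 (A_smooth R1 R2) \<gamma>)) \<and>
         (a_opt M1 R1 R2 = R1 \<and> R1 > x0 M1 R2 \<longrightarrow>
            (\<forall>\<gamma>>1.
               \<not> profile_estimate M1 M2 R1 R2 (A_BV R1 R2) \<gamma> \<and>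
               \<not> profile_estimate M1 M2 R1 R2 (A_smooth R1 R2) \<gamma> \<and>
               \<not> metric_estimate M1 M2 R1 R2 (A_BV R1 R2) \<gamma> \<and>
               \<not> metric_estimate M1 M2 R1 R2 (A_smooth R1 R2) \<gamma>))"
proof -
  note not_smooth = not_profile_estimate_smooth[OF assms] not_metric_estimate_smooth[OF assms]
  \<comment> \<open>An estimate on the BV class restricts to the smooth class it contains, so
    failure for smooth profiles transfers to BV.\<close>
  note not_BV = contrapos_nn[OF _ profile_estimate_subset[OF A_smooth_subset_A_BV]]
    contrapos_nn[OF _ metric_estimate_subset[OF A_smooth_subset_A_BV]]
  show ?thesis
  proof (intro conjI impI allI; (elim conjE)?)
    fix \<gamma> :: real
    assume "a_opt M1 R1 R2 = x0 M1 R2" "1 / 2 < \<gamma>"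
    then have p: "2 = (1::real) \<or> 2 = (2::real) \<and> critical_cubic M1 R2 (a_opt M1 R1 R2) = 0" "1 < 2 * \<gamma>"
      using critical_cubic_x0[of M1 R2] assms by simp_all
    note ns = not_smooth(1)[OF p] not_smooth(2)[OF p]
    show "\<not> profile_estimate M1 M2 R1 R2 (A_smooth R1 R2) \<gamma>"
      "\<not> metric_estimate M1 M2 R1 R2 (A_smooth R1 R2) \<gamma>"
      by (fact ns)+
    show "\<not> profile_estimate M1 M2 R1 R2 (A_BV R1 R2) \<gamma>"
      by (rule not_BV(1)[OF ns(1)])
    show "\<not> metric_estimate M1 M2 R1 R2 (A_BV R1 R2) \<gamma>"
      by (rule not_BV(2)[OF ns(2)])
  next
    fix \<gamma> :: real
    assume "1 < \<gamma>"
    then have p: "1 = (1::real) \<or> 1 = (2::real) \<and> critical_cubic M1 R2 (a_opt M1 R1 R2) = 0" "1 < 1 * \<gamma>"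
      by simp_all
    note ns = not_smooth(1)[OF p] not_smooth(2)[OF p]
    show "\<not> profile_estimate M1 M2 R1 R2 (A_smooth R1 R2) \<gamma>"
      "\<not> metric_estimate M1 M2 R1 R2 (A_smooth R1 R2) \<gamma>"
      by (fact ns)+
    show "\<not> profile_estimate M1 M2 R1 R2 (A_BV R1 R2) \<gamma>"
      by (rule not_BV(1)[OF ns(1)])
    show "\<not> metric_estimate M1 M2 R1 R2 (A_BV R1 R2) \<gamma>"
      by (rule not_BV(2)[OF ns(2)])
  qed
qed

end
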